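(* Let $x^\star$ be a local minimizer of (NSOCP) satisfying Robinson's constraint qualification and the WCR property. Then there exist Lagrange multipliers $\omega^\star=(\omega_1^\star,\dots,\omega_r^\star)\in\mathcal{K}$ and $\mu^\star\in\mathbb{R}^p$ such that the KKT conditions hold at $x^\star$ with $(\omega^\star,\mu^\star)$ and WSOC holds at $x^\star$ with respect to these same multipliers, that is, $$d^\top\big(\nabla_x^2L(x^\star,\omega^\star,\mu^\star)+\sigma(x^\star,\omega^\star)\big)d\ \geq\ 0\quad\text{for every } d\in S(x^\star).$$
   Context: For $m\ge 2$, the second-order (Lorentz) cone is $\mathbb{L}^m=\{(w_0,\bar w)\in\mathbb{R}\times\mathbb{R}^{m-1}: w_0\ge\|\bar w\|_2\}$, and $\mathbb{L}^1=\{w\in\mathbb{R}: w\ge 0\}$. For $w\in\mathbb{R}^{m}$, write $w=(w_0,\bar w)$, also $[w]_0=w_0$, with $w_0$ the first entry and $\bar w=\overline{w}$ the subvector of the remaining entries. Problem (NSOCP): minimize $f(x)$ over $x\in\mathbb{R}^n$ subject to $g_i(x)\in\mathcal{K}_i$ for $i\in\{1,\dots,r\}$ and $h(x)=0$, where $\mathcal{K}_i=\mathbb{L}^{m_i}$, $m_1+\dots+m_r=m$, $\mathcal{K}=\mathcal{K}_1\times\dots\times\mathcal{K}_r\subset\mathbb{R}^m$, and $f:\mathbb{R}^n\to\mathbb{R}$, $g_i:\mathbb{R}^n\to\mathbb{R}^{m_i}$, $h:\mathbb{R}^n\to\mathbb{R}^p$ are twice continuously differentiable; $g=(g_1,\dots,g_r)$.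 Euclidean inner products are used. $Dg_i(x)$ and $Dh(x)$ denote Jacobian matrices, and $\nabla g_{ij}(x)$ is the transpose of the $j$-th row of $Dg_i(x)$. Robinson's constraint qualification holds at a feasible point $x$ if $Dh(x)$ has full row rank and there is $d\in\mathbb{R}^n$ with $g(x)+Dg(x)d\in\mathrm{int}(\mathcal{K})$ and $Dh(x)d=0$. The Lagrangian is $L(x,\omega,\mu)=f(x)-\langle g(x),\omega\rangle+\langle h(x),\mu\rangle$; $\nabla_xL$ and $\nabla_x^2L$ are its gradient and Hessian in $x$. The KKT conditions hold at a feasible $x^\star$ with Lagrange multipliers $\omega^\star\in\mathcal{K}$, $\mu^\star\in\mathbb{R}^p$ if $\nabla_xL(x^\star,\omega^\star,\mu^\star)=0$ and $\langle g(x^\star),\omega^\star\rangle=0$. Let $\mathrm{bd}^+(\mathcal{K}_i)$ be the boundary of $\mathcal{K}_i$ excluding the origin. Index sets: $I_0(x^\star)=\{i: g_i(x^\star)=0\}$, $I_B(x^\star)=\{i: g_i(x^\star)\in\mathrm{bd}^+(\mathcal{K}_i)\}$, $I_{BB}(x^\star,\omega^\star)=\{i\in I_B(x^\star):\omega_i^\star\in\mathrm{bd}^+(\mathcal{K}_i)\}$. Let $\Gamma_i=\mathrm{diag}(1,-1,\dots,-1)\in\mathbb{R}^{m_i\times m_i}$ and $\tilde g_i(x)=(\|\overline{g_i(x)}\|_2,\overline{g_i(x)})$. WCR property at a feasible $x^\star$: there is a neighborhood $\mathcal{N}$ of $x^\star$ such that the family of vectors $$\{\nabla h_i(x)\}_{i\in\{1,\dots,p\}}\cup\{\nabla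 g_{ij}(x)\}_{i\in I_0(x^\star),\,j\in\{1,\dots,m_i\}}\cup\{Dg_i(x)^\top\Gamma_i\tilde g_i(x)\}_{i\in I_B(x^\star)}$$ has the same rank (dimension of its span) for all $x\in\mathcal{N}$. Sigma-term: $\sigma(x^\star,\omega^\star)=\sum_{i\in I_{BB}(x^\star,\omega^\star)}-\dfrac{[\omega_i^\star]_0}{[g_i(x^\star)]_0}\,Dg_i(x^\star)^\top\Gamma_iDg_i(x^\star)$. Critical cone: $C(x^\star)=\{d\in\mathbb{R}^n:\nabla f(x^\star)^\top d=0,\ Dh(x^\star)d=0,\ Dg(x^\star)d\in T_{\mathcal{K}}(g(x^\star))\}$, where $T_{\mathcal{K}}$ is the (Bouligand) tangent cone. Critical subspace: $S(x^\star)=C(x^\star)\cap(-C(x^\star))$ (the lineality space of $C(x^\star)$), which at a KKT point can be written as $$S(x^\star)=\{d\in\mathbb{R}^n: Dh(x^\star)d=0;\ Dg_i(x^\star)d=0,\ i\in I_0(x^\star);\ g_i(x^\star)^\top\Gamma_iDg_i(x^\star)d=0,\ i\in I_B(x^\star)\}.$$ *)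

theory Defs
  imports "HOL-Analysis.Analysis"
begin

section \<open>Gradients, Hessians, Jacobians\<close>

definition grad :: "(real^'n \<Rightarrow> real) \<Rightarrow> real^'n \<Rightarrow> real^'n" where
  "grad \<phi> x = (THE D. GDERIV \<phi> x :> D)"

definition hessian :: "(real^'n \<Rightarrow> real) \<Rightarrow> real^'n \<Rightarrow> real^'n^'n" where
  "hessian \<phi> x = jacobian (grad \<phi>) (at x)"

definition C2 :: "(real^'n \<Rightarrow> real) \<Rightarrow> bool" where
  "C2 \<phi> \<longleftrightarrow> (\<forall>x. \<phi> differentiable (at x)) \<and> (\<forall>x. grad \<phi> differentiable (at x))
           \<and> continuous_on UNIV (hessian \<phi>)"

lemma grad_eq:
  assumes "GDERIV \<phi> x :> D"
  shows "grad \<phi> x = D"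
  unfolding grad_def
proof (rule the_equality)
  show "GDERIV \<phi> x :> D"
    by (fact assms)
next
  fix E assume "GDERIV \<phi> x :> E"
  with assms have "(\<lambda>h. h \<bullet> E) = (\<lambda>h. h \<bullet> D)"
    unfolding gderiv_def using has_derivative_unique by blast
  then have "\<forall>h. h \<bullet> E = h \<bullet> D"
    by (simp add: fun_eq_iff)
  then show "E = D"
    using vector_eq_ldot by blast
qed

text \<open>Since the dimensions of the constraint blocks vary, a vector of \<open>\<real>\<^sup>m\<close> is a sequence that vanishes
  from index \<open>m\<close> on, that is, an element of the topological space \<open>Euclidean_space m\<close>; its
  entries are numbered from \<open>0\<close>. For \<open>G\<close> with values in \<open>\<real>\<^sup>m\<close>, the products of the Jacobian
  matrix \<open>DG(x)\<close> (whose \<open>j\<close>-th row is the gradient of the \<open>j\<close>-th component) and of its transpose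
  with a vector are as follows.\<close>

definition Jmult :: "nat \<Rightarrow> (real^'n \<Rightarrow> nat \<Rightarrow> real) \<Rightarrow> real^'n \<Rightarrow> real^'n \<Rightarrow> (nat \<Rightarrow> real)" where
  "Jmult m G x d = (\<lambda>j. if j < m then grad (\<lambda>y. G y j) x \<bullet> d else 0)"

definition JTmult :: "nat \<Rightarrow> (real^'n \<Rightarrow> nat \<Rightarrow> real) \<Rightarrow> real^'n \<Rightarrow> (nat \<Rightarrow> real) \<Rightarrow> real^'n" where
  "JTmult m G x v = (\<Sum>j<m. v j *\<^sub>R grad (\<lambda>y. G y j) x)"


section \<open>The second-order cone\<close>

text \<open>For \<open>m = 1\<close> the norm is an empty sum and the cone is the nonnegative half-line.\<close>

definition tail_norm :: "nat \<Rightarrow> (nat \<Rightarrow> real) \<Rightarrow> real" where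
  "tail_norm m w = L2_set w {1..<m}"

definition lorentz :: "nat \<Rightarrow> (nat \<Rightarrow> real) set" where
  "lorentz m = {w \<in> topspace (Euclidean_space m). w 0 \<ge> tail_norm m w}"

definition bd_plus :: "nat \<Rightarrow> (nat \<Rightarrow> real) set" where
  "bd_plus m = (Euclidean_space m frontier_of lorentz m) - {\<lambda>_. 0}"

text \<open>Multiplication by \<open>\<Gamma> = diag(1,-1,\<dots>,-1)\<close>.\<close>

definition Gam :: "(nat \<Rightarrow> real) \<Rightarrow> (nat \<Rightarrow> real)" where
  "Gam w = (\<lambda>j. if j = 0 then w j else - w j)"

definition tilde :: "nat \<Rightarrow> (nat \<Rightarrow> real) \<Rightarrow> (nat \<Rightarrow> real)" where
  "tilde m w = (\<lambda>j. if j = 0 then tail_norm m w else w j)"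


section \<open>Block vectors and the product cone\<close>

text \<open>Elements of \<open>\<real>\<^bsup>m 0\<^esup> \<times> \<dots> \<times> \<real>\<^bsup>m (r-1)\<^esup>\<close>, extended by zero blocks. Function types carry the topology of
  pointwise convergence, which induces the Euclidean topology on this finite-dimensional space.\<close>

definition block_space :: "nat \<Rightarrow> (nat \<Rightarrow> nat) \<Rightarrow> (nat \<Rightarrow> nat \<Rightarrow> real) set" where
  "block_space r m = {w. (\<forall>i<r. w i \<in> topspace (Euclidean_space (m i))) \<and> (\<forall>i\<ge>r. w i = (\<lambda>_. 0))}"

definition Kcone :: "nat \<Rightarrow> (nat \<Rightarrow> nat) \<Rightarrow> (nat \<Rightarrow> nat \<Rightarrow> real) set" where
  "Kcone r m = {w \<in> block_space r m. \<forall>i<r. w i \<in> lorentz (m i)}"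

definition block_inner :: "nat \<Rightarrow> (nat \<Rightarrow> nat) \<Rightarrow> (nat \<Rightarrow> nat \<Rightarrow> real) \<Rightarrow> (nat \<Rightarrow> nat \<Rightarrow> real) \<Rightarrow> real" where
  "block_inner r m v w = (\<Sum>i<r. \<Sum>j<m i. v i j * w i j)"

definition block_Jmult ::
  "nat \<Rightarrow> (nat \<Rightarrow> nat) \<Rightarrow> (real^'n \<Rightarrow> nat \<Rightarrow> nat \<Rightarrow> real) \<Rightarrow> real^'n \<Rightarrow> real^'n \<Rightarrow> (nat \<Rightarrow> nat \<Rightarrow> real)" where
  "block_Jmult r m g x d = (\<lambda>i. if i < r then Jmult (m i) (\<lambda>y. g y i) x d else (\<lambda>_. 0))"

definition tangent_cone :: "(nat \<Rightarrow> nat \<Rightarrow> real) set \<Rightarrow> (nat \<Rightarrow> nat \<Rightarrow> real) \<Rightarrow> (nat \<Rightarrow> nat \<Rightarrow> real) set" where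
  "tangent_cone A y = {w. \<exists>t u. (\<forall>k::nat. t k > (0::real)) \<and> t \<longlonglongrightarrow> 0 \<and> u \<longlonglongrightarrow> w \<and>
                               (\<forall>k. (\<lambda>i j. y i j + t k * u k i j) \<in> A)}"


section \<open>The nonlinear second-order cone program\<close>

text \<open>Throughout, \<open>g x i j\<close> is the entry \<open>j < m i\<close> of the block \<open>i < r\<close> of \<open>g(x)\<close>, and \<open>h x i\<close> is the
  entry \<open>i < p\<close> of \<open>h(x)\<close>.\<close>

definition nsocp_data ::
  "(real^'n \<Rightarrow> real) \<Rightarrow> nat \<Rightarrow> (nat \<Rightarrow> nat) \<Rightarrow> (real^'n \<Rightarrow> nat \<Rightarrow> nat \<Rightarrow> real) \<Rightarrow>
   nat \<Rightarrow> (real^'n \<Rightarrow> nat \<Rightarrow> real) \<Rightarrow> bool" where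
  "nsocp_data f r m g p h \<longleftrightarrow>
     (\<forall>i<r. m i \<ge> 1) \<and>
     (\<forall>x. g x \<in> block_space r m) \<and>
     (\<forall>x. h x \<in> topspace (Euclidean_space p)) \<and>
     C2 f \<and>
     (\<forall>i<r. \<forall>j<m i. C2 (\<lambda>x. g x i j)) \<and>
     (\<forall>i<p. C2 (\<lambda>x. h x i))"

definition feasible ::
  "nat \<Rightarrow> (nat \<Rightarrow> nat) \<Rightarrow> (real^'n \<Rightarrow> nat \<Rightarrow> nat \<Rightarrow> real) \<Rightarrow> (real^'n \<Rightarrow> nat \<Rightarrow> real) \<Rightarrow> (real^'n) set" where
  "feasible r m g h = {x. g x \<in> Kcone r m \<and> h x = (\<lambda>_. 0)}"

definition local_minimizer ::
  "(real^'n \<Rightarrow> real) \<Rightarrow> nat \<Rightarrow> (nat \<Rightarrow> nat) \<Rightarrow> (real^'n \<Rightarrow> nat \<Rightarrow> nat \<Rightarrow> real) \<Rightarrow>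
   (real^'n \<Rightarrow> nat \<Rightarrow> real) \<Rightarrow> real^'n \<Rightarrow> bool" where
  "local_minimizer f r m g h x \<longleftrightarrow> x \<in> feasible r m g h \<and>
     (\<exists>N. open N \<and> x \<in> N \<and> (\<forall>y \<in> N \<inter> feasible r m g h. f x \<le> f y))"

text \<open>The rank of a Jacobian matrix, or of a family of vectors, is the dimension \<open>dim\<close> of the span of
  its rows, respectively its members.\<close>

definition robinson_cq ::
  "nat \<Rightarrow> (nat \<Rightarrow> nat) \<Rightarrow> (real^'n \<Rightarrow> nat \<Rightarrow> nat \<Rightarrow> real) \<Rightarrow> nat \<Rightarrow>
   (real^'n \<Rightarrow> nat \<Rightarrow> real) \<Rightarrow> real^'n \<Rightarrow> bool" where
  "robinson_cq r m g p h x \<longleftrightarrow> x \<in> feasible r m g h \<and>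
     dim ((\<lambda>i. grad (\<lambda>y. h y i) x) ` {..<p}) = p \<and>
     (\<exists>d. (\<lambda>i j. g x i j + block_Jmult r m g x d i j)
            \<in> top_of_set (block_space r m) interior_of Kcone r m \<and>
          Jmult p h x d = (\<lambda>_. 0))"

definition lagrangian ::
  "(real^'n \<Rightarrow> real) \<Rightarrow> nat \<Rightarrow> (nat \<Rightarrow> nat) \<Rightarrow> (real^'n \<Rightarrow> nat \<Rightarrow> nat \<Rightarrow> real) \<Rightarrow> nat \<Rightarrow>
   (real^'n \<Rightarrow> nat \<Rightarrow> real) \<Rightarrow> real^'n \<Rightarrow> (nat \<Rightarrow> nat \<Rightarrow> real) \<Rightarrow> (nat \<Rightarrow> real) \<Rightarrow> real" where
  "lagrangian f r m g p h x \<omega> \<mu> = f x - block_inner r m (g x) \<omega> + (\<Sum>i<p. h x i * \<mu> i)"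

definition KKT ::
  "(real^'n \<Rightarrow> real) \<Rightarrow> nat \<Rightarrow> (nat \<Rightarrow> nat) \<Rightarrow> (real^'n \<Rightarrow> nat \<Rightarrow> nat \<Rightarrow> real) \<Rightarrow> nat \<Rightarrow>
   (real^'n \<Rightarrow> nat \<Rightarrow> real) \<Rightarrow> real^'n \<Rightarrow> (nat \<Rightarrow> nat \<Rightarrow> real) \<Rightarrow> (nat \<Rightarrow> real) \<Rightarrow> bool" where
  "KKT f r m g p h x \<omega> \<mu> \<longleftrightarrow>
     x \<in> feasible r m g h \<and> \<omega> \<in> Kcone r m \<and> \<mu> \<in> topspace (Euclidean_space p) \<and>
     grad (\<lambda>y. lagrangian f r m g p h y \<omega> \<mu>) x = 0 \<and>
     block_inner r m (g x) \<omega> = 0"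

definition I_0 :: "nat \<Rightarrow> (real^'n \<Rightarrow> nat \<Rightarrow> nat \<Rightarrow> real) \<Rightarrow> real^'n \<Rightarrow> nat set" where
  "I_0 r g x = {i. i < r \<and> g x i = (\<lambda>_. 0)}"

definition I_B :: "nat \<Rightarrow> (nat \<Rightarrow> nat) \<Rightarrow> (real^'n \<Rightarrow> nat \<Rightarrow> nat \<Rightarrow> real) \<Rightarrow> real^'n \<Rightarrow> nat set" where
  "I_B r m g x = {i. i < r \<and> g x i \<in> bd_plus (m i)}"

definition I_BB ::
  "nat \<Rightarrow> (nat \<Rightarrow> nat) \<Rightarrow> (real^'n \<Rightarrow> nat \<Rightarrow> nat \<Rightarrow> real) \<Rightarrow> real^'n \<Rightarrow> (nat \<Rightarrow> nat \<Rightarrow> real) \<Rightarrow> nat set" where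
  "I_BB r m g x \<omega> = {i \<in> I_B r m g x. \<omega> i \<in> bd_plus (m i)}"

text \<open>The index sets are taken at the reference point \<open>xs\<close>, the vectors at the nearby point \<open>x\<close>.\<close>

definition wcr_family ::
  "nat \<Rightarrow> (nat \<Rightarrow> nat) \<Rightarrow> (real^'n \<Rightarrow> nat \<Rightarrow> nat \<Rightarrow> real) \<Rightarrow> nat \<Rightarrow>
   (real^'n \<Rightarrow> nat \<Rightarrow> real) \<Rightarrow> real^'n \<Rightarrow> real^'n \<Rightarrow> (real^'n) set" where
  "wcr_family r m g p h xs x =
     {grad (\<lambda>y. h y i) x | i. i < p} \<union>
     {grad (\<lambda>y. g y i j) x | i j. i \<in> I_0 r g xs \<and> j < m i} \<union>
     {JTmult (m i) (\<lambda>y. g y i) x (Gam (tilde (m i) (g x i))) | i. i \<in> I_B r m g xs}"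

definition WCR ::
  "nat \<Rightarrow> (nat \<Rightarrow> nat) \<Rightarrow> (real^'n \<Rightarrow> nat \<Rightarrow> nat \<Rightarrow> real) \<Rightarrow> nat \<Rightarrow>
   (real^'n \<Rightarrow> nat \<Rightarrow> real) \<Rightarrow> real^'n \<Rightarrow> bool" where
  "WCR r m g p h xs \<longleftrightarrow> xs \<in> feasible r m g h \<and>
     (\<exists>N. open N \<and> xs \<in> N \<and>
        (\<forall>x\<in>N. dim (wcr_family r m g p h xs x) = dim (wcr_family r m g p h xs xs)))"

definition sigma_term ::
  "nat \<Rightarrow> (nat \<Rightarrow> nat) \<Rightarrow> (real^'n \<Rightarrow> nat \<Rightarrow> nat \<Rightarrow> real) \<Rightarrow> real^'n \<Rightarrow>
   (nat \<Rightarrow> nat \<Rightarrow> real) \<Rightarrow> real^'n^'n" where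
  "sigma_term r m g x \<omega> = (\<Sum>i \<in> I_BB r m g x \<omega>.
     (- (\<omega> i 0 / g x i 0)) *\<^sub>R
       matrix (\<lambda>d. JTmult (m i) (\<lambda>y. g y i) x (Gam (Jmult (m i) (\<lambda>y. g y i) x d))))"

definition critical_cone ::
  "(real^'n \<Rightarrow> real) \<Rightarrow> nat \<Rightarrow> (nat \<Rightarrow> nat) \<Rightarrow> (real^'n \<Rightarrow> nat \<Rightarrow> nat \<Rightarrow> real) \<Rightarrow> nat \<Rightarrow>
   (real^'n \<Rightarrow> nat \<Rightarrow> real) \<Rightarrow> real^'n \<Rightarrow> (real^'n) set" where
  "critical_cone f r m g p h x =
     {d. grad f x \<bullet> d = 0 \<and> Jmult p h x d = (\<lambda>_. 0) \<and>
         block_Jmult r m g x d \<in> tangent_cone (Kcone r m) (g x)}"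

definition critical_subspace ::
  "(real^'n \<Rightarrow> real) \<Rightarrow> nat \<Rightarrow> (nat \<Rightarrow> nat) \<Rightarrow> (real^'n \<Rightarrow> nat \<Rightarrow> nat \<Rightarrow> real) \<Rightarrow> nat \<Rightarrow>
   (real^'n \<Rightarrow> nat \<Rightarrow> real) \<Rightarrow> real^'n \<Rightarrow> (real^'n) set" where
  "critical_subspace f r m g p h x =
     critical_cone f r m g p h x \<inter> uminus ` critical_cone f r m g p h x"

definition WSOC ::
  "(real^'n \<Rightarrow> real) \<Rightarrow> nat \<Rightarrow> (nat \<Rightarrow> nat) \<Rightarrow> (real^'n \<Rightarrow> nat \<Rightarrow> nat \<Rightarrow> real) \<Rightarrow> nat \<Rightarrow>
   (real^'n \<Rightarrow> nat \<Rightarrow> real) \<Rightarrow> real^'n \<Rightarrow> (nat \<Rightarrow> nat \<Rightarrow> real) \<Rightarrow> (nat \<Rightarrow> real) \<Rightarrow> bool" where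
  "WSOC f r m g p h x \<omega> \<mu> \<longleftrightarrow>
     (\<forall>d \<in> critical_subspace f r m g p h x.
        d \<bullet> ((hessian (\<lambda>y. lagrangian f r m g p h y \<omega> \<mu>) x + sigma_term r m g x \<omega>) *v d) \<ge> 0)"

end

theory Submission
  imports Defs
begin

text \<open>The proof is an external penalty method for a reduced problem all of whose constraints vanish at the
minimizer \<open>xs\<close>.

\<^emph>\<open>Reduction.\<close> Blocks \<open>g\<^sub>i(xs)\<close> in the interior of their cone impose nothing nearby. Near a nonzero boundary
point the cone is described by one smooth inequality \<open>gap\<^sub>i = [g\<^sub>i]\<^sub>0 - \<parallel>g\<^sub>i\<parallel> \<ge> 0\<close>, the norm being that of the
tail. Its gradient is the vector \<open>Dg\<^sub>i\<^sup>T \<Gamma> g~\<^sub>i\<close> of the WCR family divided by the norm of the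
tail, and its Hessian contains the curvature of the cone. So the problem is locally: minimize \<open>f\<close> subject to \<open>G(x) \<in> Q\<close>, where \<open>G\<close> collects \<open>h\<close>, the
\<open>gap\<^sub>i\<close> for \<open>i \<in> I\<^sub>B\<close> and the blocks \<open>g\<^sub>i\<close> for \<open>i \<in> I\<^sub>0\<close>, the set \<open>Q\<close> is a closed convex cone and \<open>G(xs) = 0\<close>. The
WCR property says that the gradients of all components of \<open>G\<close> have constant rank near \<open>xs\<close>.

\<^emph>\<open>Penalty.\<close> The squared distance of \<open>G(x)\<close> to \<open>Q\<close> is only once differentiable. Instead of differentiating
it twice, one minimizes \<open>f(x) + \<parallel>x - xs\<parallel>\<^sup>4/2 + (\<rho>/2) \<parallel>G(x) - P\<parallel>\<^sup>2\<close> jointly over \<open>x\<close> near \<open>xs\<close> and \<open>P \<in> Q\<close>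
(lemma \<open>penalty_minimizers\<close>). With \<open>P\<close> fixed at its optimal value this is a \<open>C\<^sup>2\<close> function of \<open>x\<close>, so that the
classical first- and second-order conditions apply, with multiplier \<open>\<rho> (G(x) - P)\<close>; optimality in \<open>P\<close> puts
this multiplier into the polar cone of \<open>Q\<close>. In directions that annihilate the gradients of \<open>G\<close> at \<open>x\<close> the
squares of these gradients drop out of the second-order condition, and what is left is the Hessian of the
Lagrangian plus that of the quartic term, which vanishes in the limit \<open>\<rho> \<rightarrow> \<infinity>\<close>.

\<^emph>\<open>Limits.\<close> Robinson's condition leaves no nonzero element of the polar cone that annihilates the gradients
at \<open>xs\<close>; hence the multipliers stay bounded (\<open>bounded_multipliers\<close>). Constant rank makes every direction in
the kernel at \<open>xs\<close> a limit of kernel directions at the penalty minimizers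
(\<open>kernel_of_constant_rank_family\<close>). Passing to the limit yields the general
\<open>constant_rank_second_order_necessary\<close>.

\<^emph>\<open>Translation back.\<close> The multiplier of \<open>gap\<^sub>i\<close> becomes the multiple \<open>\<tau> (1, -tail/norm)\<close> of the inner normal
of the cone, and minus \<open>\<tau>\<close> times the curvature part of the Hessian of \<open>gap\<^sub>i\<close> is exactly the sigma-term (\<open>inner_gap''\<close>,
\<open>inner_sigma_term\<close>). A direction \<open>d\<close> such that \<open>d\<close> and \<open>-d\<close> are critical is tangent in both senses and so
annihilates all gradients of \<open>G\<close> (\<open>critical_subspace_D\<close>).\<close>

section \<open>Twice continuously differentiable functions\<close>

text \<open>The second derivative is kept as a map of vectors, not as a matrix: sums, products with scalars and
compositions then have second derivatives that can be written down directly.\<close>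

definition C2_on ::
  "'a::euclidean_space set \<Rightarrow> ('a \<Rightarrow> real) \<Rightarrow> ('a \<Rightarrow> 'a) \<Rightarrow> ('a \<Rightarrow> 'a \<Rightarrow> 'a) \<Rightarrow> bool" where
  "C2_on U \<phi> \<phi>' \<phi>'' \<longleftrightarrow> (\<forall>x\<in>U. (\<phi> has_derivative (\<lambda>v. v \<bullet> \<phi>' x)) (at x) \<and>
     (\<phi>' has_derivative \<phi>'' x) (at x) \<and> (\<forall>v. isCont (\<lambda>y. \<phi>'' y v) x))"

lemma C2_onD:
  assumes "C2_on U \<phi> \<phi>' \<phi>''" "x \<in> U"
  shows "(\<phi> has_derivative (\<lambda>v. v \<bullet> \<phi>' x)) (at x)" "(\<phi>' has_derivative \<phi>'' x) (at x)"
    "isCont (\<lambda>y. \<phi>'' y v) x" "linear (\<phi>'' x)" "isCont \<phi> x" "isCont \<phi>' x"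
proof -
  show 1: "(\<phi> has_derivative (\<lambda>v. v \<bullet> \<phi>' x)) (at x)" "(\<phi>' has_derivative \<phi>'' x) (at x)"
    "isCont (\<lambda>y. \<phi>'' y v) x"
    using assms unfolding C2_on_def by auto
  show "linear (\<phi>'' x)" "isCont \<phi> x" "isCont \<phi>' x"
    using 1 has_derivative_continuous has_derivative_linear by blast+
qed

lemma C2_on_subset: "C2_on U \<phi> \<phi>' \<phi>'' \<Longrightarrow> V \<subseteq> U \<Longrightarrow> C2_on V \<phi> \<phi>' \<phi>''"
  unfolding C2_on_def by auto

lemma C2_on_add:
  assumes "C2_on U \<phi> \<phi>' \<phi>''" "C2_on U \<psi> \<psi>' \<psi>''"
  shows "C2_on U (\<lambda>x. \<phi> x + \<psi> x) (\<lambda>x. \<phi>' x + \<psi>' x) (\<lambda>x v. \<phi>'' x v + \<psi>'' x v)"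
  using assms unfolding C2_on_def
  by (auto simp: inner_add_right intro!: has_derivative_add continuous_intros)

lemma C2_on_diff:
  assumes "C2_on U \<phi> \<phi>' \<phi>''" "C2_on U \<psi> \<psi>' \<psi>''"
  shows "C2_on U (\<lambda>x. \<phi> x - \<psi> x) (\<lambda>x. \<phi>' x - \<psi>' x) (\<lambda>x v. \<phi>'' x v - \<psi>'' x v)"
  using assms unfolding C2_on_def
  by (auto simp: inner_diff_right intro!: has_derivative_diff continuous_intros)

lemma C2_on_sum:
  assumes "\<And>a. a \<in> A \<Longrightarrow> C2_on U (\<phi> a) (\<phi>' a) (\<phi>'' a)"
  shows "C2_on U (\<lambda>x. \<Sum>a\<in>A. \<phi> a x) (\<lambda>x. \<Sum>a\<in>A. \<phi>' a x) (\<lambda>x v. \<Sum>a\<in>A. \<phi>'' a x v)"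
  using assms unfolding C2_on_def
  by (auto simp: inner_sum_right intro!: has_derivative_sum continuous_intros)

lemma C2_on_compose:
  fixes \<phi> :: "'a::euclidean_space \<Rightarrow> real" and \<psi> \<psi>' \<psi>'' :: "real \<Rightarrow> real"
  assumes \<phi>: "C2_on U \<phi> \<phi>' \<phi>''"
    and \<psi>: "\<And>x. x \<in> U \<Longrightarrow> (\<psi> has_real_derivative \<psi>' (\<phi> x)) (at (\<phi> x))"
    and \<psi>': "\<And>x. x \<in> U \<Longrightarrow> (\<psi>' has_real_derivative \<psi>'' (\<phi> x)) (at (\<phi> x))"
    and \<psi>'': "\<And>x. x \<in> U \<Longrightarrow> isCont \<psi>'' (\<phi> x)"
  shows "C2_on U (\<lambda>x. \<psi> (\<phi> x)) (\<lambda>x. \<psi>' (\<phi> x) *\<^sub>R \<phi>' x)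
    (\<lambda>x v. \<psi>' (\<phi> x) *\<^sub>R \<phi>'' x v + (\<psi>'' (\<phi> x) * (v \<bullet> \<phi>' x)) *\<^sub>R \<phi>' x)"
  unfolding C2_on_def
proof (intro ballI conjI allI)
  fix x assume x: "x \<in> U"
  note d = C2_onD[OF \<phi> x]
  show "((\<lambda>x. \<psi> (\<phi> x)) has_derivative (\<lambda>v. v \<bullet> \<psi>' (\<phi> x) *\<^sub>R \<phi>' x)) (at x)"
    using has_derivative_compose[OF d(1) \<psi>[OF x, unfolded has_field_derivative_def]] by simp
  have "((\<lambda>x. \<psi>' (\<phi> x)) has_derivative (\<lambda>v. \<psi>'' (\<phi> x) * (v \<bullet> \<phi>' x))) (at x)"
    using has_derivative_compose[OF d(1) \<psi>'[OF x, unfolded has_field_derivative_def]] by simp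
  from has_derivative_scaleR[OF this d(2)]
  show "((\<lambda>x. \<psi>' (\<phi> x) *\<^sub>R \<phi>' x) has_derivative
        (\<lambda>v. \<psi>' (\<phi> x) *\<^sub>R \<phi>'' x v + (\<psi>'' (\<phi> x) * (v \<bullet> \<phi>' x)) *\<^sub>R \<phi>' x)) (at x)" .
  fix v
  have "isCont (\<lambda>y. \<psi>' (\<phi> y)) x" "isCont (\<lambda>y. \<psi>'' (\<phi> y)) x"
    using d(5) \<psi>'[OF x] \<psi>''[OF x] DERIV_isCont isCont_o2 by blast+
  then show "isCont (\<lambda>x. \<psi>' (\<phi> x) *\<^sub>R \<phi>'' x v + (\<psi>'' (\<phi> x) * (v \<bullet> \<phi>' x)) *\<^sub>R \<phi>' x) x"
    using d(3,6) by (intro continuous_intros) auto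
qed

lemma C2_on_square:
  assumes "C2_on U \<phi> \<phi>' \<phi>''"
  shows "C2_on U (\<lambda>x. c / 2 * (\<phi> x - t)\<^sup>2) (\<lambda>x. (c * (\<phi> x - t)) *\<^sub>R \<phi>' x)
    (\<lambda>x v. (c * (\<phi> x - t)) *\<^sub>R \<phi>'' x v + (c * (v \<bullet> \<phi>' x)) *\<^sub>R \<phi>' x)"
proof -
  have 1: "((\<lambda>s. c / 2 * (s - t)\<^sup>2) has_real_derivative c * (s - t)) (at s)" for s
    by (auto intro!: derivative_eq_intros)
  have 2: "((\<lambda>s. c * (s - t)) has_real_derivative c) (at s)" for s
    by (auto intro!: derivative_eq_intros)
  show ?thesis
    using C2_on_compose[OF assms, of "\<lambda>s. c / 2 * (s - t)\<^sup>2" "\<lambda>s. c * (s - t)" "\<lambda>_. c"] 1 2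
    by simp
qed

text \<open>The perturbation that makes the minimizer strict. It is of fourth order so that its gradient and its Hessian both vanish at \<open>a\<close>
and leave no trace in the limit.\<close>

lemma C2_on_quartic:
  fixes a :: "'a::euclidean_space"
  shows "C2_on U (\<lambda>x. 1/2 * (((x - a) \<bullet> (x - a)))\<^sup>2) (\<lambda>x. (2 * ((x - a) \<bullet> (x - a))) *\<^sub>R (x - a))
    (\<lambda>x v. (2 * ((x - a) \<bullet> (x - a))) *\<^sub>R v + (4 * (v \<bullet> (x - a))) *\<^sub>R (x - a))"
proof -
  have "C2_on U (\<lambda>x. (x - a) \<bullet> (x - a)) (\<lambda>x. 2 *\<^sub>R (x - a)) (\<lambda>x v. 2 *\<^sub>R v)"
    unfolding C2_on_def
    by (auto intro!: derivative_eq_intros simp: inner_commute)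
  from C2_on_square[OF this, of 1 0] show ?thesis
    by (simp add: algebra_simps)
qed

text \<open>Pointwise continuity of \<open>\<phi>''\<close> suffices for a limit in which the direction varies as well, since \<open>\<phi>''\<close> is
determined by its values on the finite basis.\<close>

lemma C2_on_tendsto:
  fixes x d :: "'b \<Rightarrow> 'a::euclidean_space"
  assumes "C2_on U \<phi> \<phi>' \<phi>''" "a \<in> U" "open U" "(x \<longlongrightarrow> a) F" "(d \<longlongrightarrow> b) F"
  shows "((\<lambda>k. d k \<bullet> \<phi>'' (x k) (d k)) \<longlongrightarrow> b \<bullet> \<phi>'' a b) F"
proof -
  have expand: "\<phi>'' y v = (\<Sum>e\<in>Basis. (v \<bullet> e) *\<^sub>R \<phi>'' y e)" if "y \<in> U" for y v
  proof -
    interpret linear "\<phi>'' y" using C2_onD(4)[OF assms(1) that] .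
    show ?thesis by (subst (1) euclidean_representation[symmetric, of v]) (simp add: sum scale)
  qed
  have "((\<lambda>k. \<phi>'' (x k) e) \<longlongrightarrow> \<phi>'' a e) F" for e
    using isCont_tendsto_compose[OF C2_onD(3)[OF assms(1,2), of e] assms(4)] .
  then have "((\<lambda>k. d k \<bullet> (\<Sum>e\<in>Basis. (d k \<bullet> e) *\<^sub>R \<phi>'' (x k) e)) \<longlongrightarrow>
        b \<bullet> (\<Sum>e\<in>Basis. (b \<bullet> e) *\<^sub>R \<phi>'' a e)) F"
    by (intro tendsto_intros assms)
  moreover have "eventually (\<lambda>k. x k \<in> U) F"
    using assms(2,3,4) topological_tendstoD by blast
  then have "eventually (\<lambda>k. d k \<bullet> \<phi>'' (x k) (d k)
      = d k \<bullet> (\<Sum>e\<in>Basis. (d k \<bullet> e) *\<^sub>R \<phi>'' (x k) e)) F"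
    by eventually_elim (simp only: expand[symmetric])
  moreover have "b \<bullet> \<phi>'' a b = b \<bullet> (\<Sum>e\<in>Basis. (b \<bullet> e) *\<^sub>R \<phi>'' a e)"
    by (simp only: expand[OF assms(2), symmetric])
  ultimately show ?thesis
    by (simp only: tendsto_cong)
qed

lemma C2_on_second_order_necessary:
  assumes C2: "C2_on U \<phi> \<phi>' \<phi>''" and U: "open U" "x \<in> U"
    and min: "\<And>y. y \<in> U \<Longrightarrow> \<phi> x \<le> \<phi> y"
  shows "\<phi>' x = 0" "d \<bullet> \<phi>'' x d \<ge> 0"
proof -
  have "(\<lambda>v. v \<bullet> \<phi>' x) = (\<lambda>v. 0)"
    using differential_zero_maxmin[OF U(2,1) C2_onD(1)[OF C2 U(2)]] min by blast
  then have "\<phi>' x \<bullet> \<phi>' x = 0" by metis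
  then show grad0: "\<phi>' x = 0" by simp
  define \<gamma> where "\<gamma> t = x + t *\<^sub>R d" for t :: real
  have \<gamma>: "(\<gamma> has_derivative (\<lambda>t. t *\<^sub>R d)) (at t)" for t
    unfolding \<gamma>_def by (auto intro!: derivative_eq_intros)
  have \<gamma>0: "\<gamma> 0 = x" by (simp add: \<gamma>_def)
  have d1: "((\<lambda>t. \<phi> (\<gamma> t)) has_real_derivative d \<bullet> \<phi>' (\<gamma> t)) (at t)" if "\<gamma> t \<in> U" for t
    using has_derivative_compose[OF \<gamma> C2_onD(1)[OF C2 that]]
    by (simp add: has_field_derivative_def mult_commute_abs)
  have "((\<lambda>t. \<phi>' (\<gamma> t)) has_derivative (\<lambda>t. \<phi>'' x (t *\<^sub>R d))) (at 0)"
    using has_derivative_compose[OF \<gamma>, of \<phi>' "\<phi>'' x" 0] C2_onD(2)[OF C2 U(2)] \<gamma>0 by simp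
  then have "((\<lambda>t. d \<bullet> \<phi>' (\<gamma> t)) has_derivative (\<lambda>t. d \<bullet> \<phi>'' x (t *\<^sub>R d))) (at 0)"
    by (rule has_derivative_inner_right)
  moreover have "(\<lambda>t. d \<bullet> \<phi>'' x (t *\<^sub>R d)) = (\<lambda>t. (d \<bullet> \<phi>'' x d) * t)"
    using C2_onD(4)[OF C2 U(2)] by (simp add: linear_cmul mult.commute)
  ultimately have d2: "((\<lambda>t. d \<bullet> \<phi>' (\<gamma> t)) has_real_derivative d \<bullet> \<phi>'' x d) (at 0)"
    by (simp add: has_field_derivative_def)
  show "d \<bullet> \<phi>'' x d \<ge> 0"
  proof (rule ccontr)
    assume "\<not> d \<bullet> \<phi>'' x d \<ge> 0"
    then obtain e where e: "e > 0" "\<And>t. 0 < t \<Longrightarrow> t < e \<Longrightarrow> d \<bullet> \<phi>' (\<gamma> t) < d \<bullet> \<phi>' (\<gamma> 0)"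
      using DERIV_neg_dec_right[OF d2] by (metis add_0 not_le)
    have "(\<gamma> \<longlongrightarrow> x) (nhds 0)"
      unfolding \<gamma>_def by (auto intro!: tendsto_eq_intros filterlim_ident)
    then have "eventually (\<lambda>t. \<gamma> t \<in> U) (nhds 0)"
      using U by (rule topological_tendstoD)
    then obtain \<delta> where \<delta>: "\<delta> > 0" "\<And>t. \<bar>t\<bar> < \<delta> \<Longrightarrow> \<gamma> t \<in> U"
      by (auto simp: eventually_nhds_metric dist_real_def)
    define s where "s = min e \<delta> / 2"
    have s: "0 < s" "s < e" "s < \<delta>" using e(1) \<delta>(1) by (auto simp: s_def min_def)
    have "\<phi> (\<gamma> s) < \<phi> (\<gamma> 0)"
    proof (rule DERIV_neg_imp_decreasing_open[OF s(1)])
      fix t assume t: "0 < t" "t < s"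
      then have "((\<lambda>t. \<phi> (\<gamma> t)) has_real_derivative d \<bullet> \<phi>' (\<gamma> t)) (at t)"
        using s by (intro d1 \<delta>(2)) auto
      moreover have "d \<bullet> \<phi>' (\<gamma> t) < 0"
        using e(2)[of t] t s grad0 \<gamma>0 by simp
      ultimately show "\<exists>y. ((\<lambda>t. \<phi> (\<gamma> t)) has_real_derivative y) (at t) \<and> y < 0" by blast
    next
      have "((\<lambda>t. \<phi> (\<gamma> t)) has_real_derivative d \<bullet> \<phi>' (\<gamma> t)) (at t within {0..s})" if "t \<in> {0..s}" for t
        using s that by (intro DERIV_subset[OF d1 subset_UNIV] \<delta>(2)) auto
      then show "continuous_on {0..s} (\<lambda>t. \<phi> (\<gamma> t))"
        by (rule DERIV_continuous_on)
    qed
    moreover have "\<gamma> s \<in> U" using s by (intro \<delta>(2)) auto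
    ultimately show False using min[of "\<gamma> s"] \<gamma>0 by simp
  qed
qed

lemma C2_on_cmult:
  assumes "C2_on U \<phi> \<phi>' \<phi>''"
  shows "C2_on U (\<lambda>x. c * \<phi> x) (\<lambda>x. c *\<^sub>R \<phi>' x) (\<lambda>x v. c *\<^sub>R \<phi>'' x v)"
  using assms unfolding C2_on_def
  by (auto intro!: has_derivative_scaleR_right has_derivative_mult_right continuous_intros)

lemma linear_matrix_vector_mult_left: "linear (\<lambda>M::real^'n^'m. M *v v)"
  by (rule linearI)
    (simp_all add: matrix_vector_mult_add_rdistrib scaleR_matrix_vector_assoc)

lemma C2_imp_C2_on:
  assumes "C2 \<phi>"
  shows "C2_on UNIV \<phi> (grad \<phi>) (\<lambda>x v. hessian \<phi> x *v v)"
  unfolding C2_on_def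
proof (intro ballI conjI allI)
  fix x
  obtain D where D: "(\<phi> has_derivative D) (at x)"
    using assms unfolding C2_def differentiable_def by blast
  have "D v = v \<bullet> (\<Sum>b\<in>Basis. D b *\<^sub>R b)" for v
  proof -
    interpret linear D using D by (rule has_derivative_linear)
    show ?thesis
      by (subst euclidean_representation[symmetric, of v])
        (simp add: sum scale inner_sum_right mult.commute)
  qed
  then obtain E where E: "D = (\<lambda>v. v \<bullet> E)" by blast
  have gd: "GDERIV \<phi> x :> E"
    using D unfolding gderiv_def E .
  show "(\<phi> has_derivative (\<lambda>v. v \<bullet> grad \<phi> x)) (at x)"
    using gd unfolding grad_eq[OF gd] gderiv_def .
  show "(grad \<phi> has_derivative (*v) (hessian \<phi> x)) (at x)"
    using assms unfolding C2_def hessian_def jacobian_works by blast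
  have "isCont (hessian \<phi>) x"
    using assms unfolding C2_def continuous_on_eq_continuous_at[OF open_UNIV] by blast
  then show "isCont (\<lambda>y. hessian \<phi> y *v v) x" for v
    by (rule bounded_linear.isCont[OF linear_linear[THEN iffD2, OF linear_matrix_vector_mult_left]])
qed

lemma grad_hessian_of_C2_on:
  assumes "C2_on UNIV \<phi> \<phi>' \<phi>''"
  shows "grad \<phi> x = \<phi>' x" "hessian \<phi> x *v d = \<phi>'' x d"
proof -
  have "grad \<phi> y = \<phi>' y" for y
    using C2_onD(1)[OF assms UNIV_I] by (intro grad_eq) (simp add: gderiv_def)
  then show "grad \<phi> x = \<phi>' x" .
  then have "grad \<phi> = \<phi>'" using \<open>\<And>y. grad \<phi> y = \<phi>' y\<close> by auto
  then show "hessian \<phi> x *v d = \<phi>'' x d"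
    using frechet_derivative_at[OF C2_onD(2)[OF assms UNIV_I, of x]] C2_onD(4)[OF assms UNIV_I, of x]
    by (simp add: hessian_def jacobian_def)
qed

section \<open>Kernels of families of vectors of constant rank\<close>

text \<open>Choose a basis \<open>B\<close> among the limit vectors \<open>v0 a\<close> and dual functionals \<open>l b\<close>. The operator
\<open>T x u = u + (\<Sum>b\<in>B. l b u (v (\<iota> b) x - b))\<close>, with \<open>\<iota> b\<close> an index of \<open>b\<close>, is a small
perturbation of the identity that carries each basis vector to its counterpart at \<open>x\<close>. It is therefore injective, so that the images of the basis stay independent, and by
the rank condition they span the whole family at \<open>x\<close>. The preimage \<open>D x\<close> of \<open>d\<close> under the adjoint of \<open>T x\<close> is
orthogonal to them, and it is close to \<open>d\<close> because \<open>T x\<close> is close to the identity.\<close>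

lemma kernel_of_constant_rank_family:
  fixes v :: "'i \<Rightarrow> 'x \<Rightarrow> 'a::euclidean_space"
  assumes "finite A" and lim: "\<And>a. a \<in> A \<Longrightarrow> (v a \<longlongrightarrow> v0 a) F"
    and rank: "eventually (\<lambda>x. dim ((\<lambda>a. v a x) ` A) = dim (v0 ` A)) F"
    and d: "\<And>a. a \<in> A \<Longrightarrow> v0 a \<bullet> d = 0"
  shows "\<exists>D. (D \<longlongrightarrow> d) F \<and> eventually (\<lambda>x. \<forall>a\<in>A. v a x \<bullet> D x = 0) F"
proof -
  obtain B where B: "B \<subseteq> v0 ` A" "independent B" "v0 ` A \<subseteq> span B"
    using maximal_independent_subset by blast
  then have finB: "finite B" using \<open>finite A\<close> finite_surj by blast
  have "\<forall>b\<in>B. \<exists>a. a \<in> A \<and> v0 a = b" using B(1) by auto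
  then obtain \<iota> where \<iota>: "\<And>b. b \<in> B \<Longrightarrow> \<iota> b \<in> A" "\<And>b. b \<in> B \<Longrightarrow> v0 (\<iota> b) = b"
    by metis
  have "\<exists>g. linear g \<and> (\<forall>c\<in>B. g c = (if c = b then 1 else 0 :: real))" for b
    using B(2) by (rule linear_independent_extend)
  then obtain l where l: "\<And>b. linear (l b)" "\<And>b c. c \<in> B \<Longrightarrow> l b c = (if c = b then 1 else 0 :: real)"
    by metis
  define \<delta> where "\<delta> x b = v (\<iota> b) x - b" for x b
  define T where "T x u = u + (\<Sum>b\<in>B. l b u *\<^sub>R \<delta> x b)" for x u
  \<comment> \<open>A bound for the operator norm of \<open>T x - id\<close>.\<close>
  define \<epsilon> where "\<epsilon> x = (\<Sum>b\<in>B. onorm (l b) * norm (\<delta> x b))" for x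
  have linT: "linear (T x)" for x
    unfolding T_def
    by (rule linearI) (simp_all add: linear_add[OF l(1)] linear_cmul[OF l(1)] algebra_simps sum.distrib scaleR_sum_right)
  have Tb: "T x b = v (\<iota> b) x" if "b \<in> B" for x b
    unfolding T_def using finB that l(2)[OF that]
    by (simp add: \<delta>_def if_distrib[of "\<lambda>t. t *\<^sub>R _"] cong: if_cong)
  have T\<epsilon>: "norm (T x u - u) \<le> \<epsilon> x * norm u" for x u
  proof -
    have "norm (T x u - u) \<le> (\<Sum>b\<in>B. norm (l b u *\<^sub>R \<delta> x b))"
      unfolding T_def by (simp add: norm_sum del: norm_scaleR)
    also have "\<dots> \<le> (\<Sum>b\<in>B. (onorm (l b) * norm u) * norm (\<delta> x b))"
      using onorm[OF linear_linear[THEN iffD2, OF l(1)]]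
      by (auto intro!: sum_mono mult_right_mono)
    also have "\<dots> = \<epsilon> x * norm u"
      unfolding \<epsilon>_def sum_distrib_right by (auto intro!: sum.cong)
    finally show ?thesis .
  qed
  have \<epsilon>0: "0 \<le> \<epsilon> x" for x
    unfolding \<epsilon>_def by (auto intro!: sum_nonneg mult_nonneg_nonneg onorm_pos_le linear_linear[THEN iffD2, OF l(1)])
  have "(\<epsilon> \<longlongrightarrow> (\<Sum>b\<in>B. onorm (l b) * norm (b - b))) F"
    unfolding \<epsilon>_def \<delta>_def
    by (intro tendsto_intros) (use lim[OF \<iota>(1)] \<iota>(2) in simp)
  then have \<epsilon>_lim: "(\<epsilon> \<longlongrightarrow> 0) F" by simp
  then have small: "eventually (\<lambda>x. \<epsilon> x < 1/2) F"
    by (rule order_tendstoD) simp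
  define D where "D x = (SOME y. \<forall>u. T x u \<bullet> y = u \<bullet> d)" for x
  have ex: "inj (T x) \<and> (\<forall>u. T x u \<bullet> D x = u \<bullet> d)" if "\<epsilon> x < 1/2" for x
  proof
    have "u = 0" if "T x u = 0" for u
      using T\<epsilon>[of x u] \<open>\<epsilon> x < 1/2\<close> that by (cases "u = 0") (auto simp: mult_le_cancel_right1)
    then show inj: "inj (T x)" using linT linear_injective_0 by blast
    obtain S where S: "linear S" "\<And>u. S (T x u) = u"
      using linear_injective_isomorphism[OF linT inj] by blast
    have "\<forall>u. T x u \<bullet> adjoint S d = u \<bullet> d"
      using adjoint_works[OF S(1)] S(2) by simp
    then show "\<forall>u. T x u \<bullet> D x = u \<bullet> d"
      unfolding D_def by (rule someI)
  qed
  have "norm (D x - d) \<le> 2 * \<epsilon> x * norm d" if "\<epsilon> x < 1/2" for x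
  proof -
    define u where "u = D x - d"
    have "norm u * norm u = u \<bullet> (D x - d)"
      by (simp add: u_def dot_square_norm power2_eq_square)
    also have "\<dots> = u \<bullet> D x - T x u \<bullet> D x"
      using ex[OF that] by (simp add: inner_diff_right)
    also have "\<dots> = - ((T x u - u) \<bullet> D x)" by (simp add: algebra_simps)
    also have "\<dots> \<le> norm (T x u - u) * norm (D x)"
      using norm_cauchy_schwarz[of "- (T x u - u)" "D x"] by (simp only: inner_minus_left norm_minus_cancel)
    also have "\<dots> \<le> (\<epsilon> x * norm u) * norm (D x)"
      by (intro mult_right_mono T\<epsilon>) simp
    finally have "norm u \<le> \<epsilon> x * norm (D x)"
      by (cases "u = 0") (use \<epsilon>0[of x] in \<open>auto simp: mult.assoc mult.left_commute\<close>)
    also have "\<dots> \<le> \<epsilon> x * (norm u + norm d)"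
      using \<epsilon>0[of x] norm_triangle_ineq[of u d] by (intro mult_left_mono) (auto simp: u_def)
    also have "\<dots> \<le> 1/2 * norm u + \<epsilon> x * norm d"
      using mult_right_mono[of "\<epsilon> x" "1/2" "norm u"] that by (simp add: distrib_left)
    finally show ?thesis by (simp add: u_def)
  qed
  with small have "eventually (\<lambda>x. norm (D x - d) \<le> 2 * \<epsilon> x * norm d) F"
    by (auto elim: eventually_mono)
  moreover have "((\<lambda>x. 2 * \<epsilon> x * norm d) \<longlongrightarrow> 0) F"
    by (rule tendsto_eq_intros \<epsilon>_lim refl | simp)+
  ultimately have "((\<lambda>x. D x - d) \<longlongrightarrow> 0) F"
    by (rule Lim_null_comparison)
  then have "(D \<longlongrightarrow> d) F" by (simp add: LIM_zero_iff)
  moreover from small rank have "eventually (\<lambda>x. \<forall>a\<in>A. v a x \<bullet> D x = 0) F"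
  proof eventually_elim
    case (elim x)
    have "dim (T x ` B) = dim B"
      using ex[OF elim(1)] by (intro dim_image_eq linT) (auto intro: inj_on_subset)
    also have "\<dots> = dim (v0 ` A)"
      using B(1,3) span_eq_dim[of B "v0 ` A"] by (metis span_superset subset_antisym dim_span dim_subset le_antisym)
    finally have "dim (T x ` B) = dim ((\<lambda>a. v a x) ` A)" using elim(2) by simp
    moreover have "T x ` B \<subseteq> (\<lambda>a. v a x) ` A" using \<iota>(1) Tb by auto
    ultimately have "span (T x ` B) = span ((\<lambda>a. v a x) ` A)"
      by (intro dim_eq_span) auto
    moreover have "D x \<bullet> w = 0" if "w \<in> span (T x ` B)" for w
    proof -
      have "orthogonal (D x) (T x b)" if "b \<in> B" for b
        using ex[OF elim(1)] d[OF \<iota>(1)[OF that]] \<iota>(2)[OF that]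
        by (simp add: orthogonal_def inner_commute)
      then show ?thesis
        using orthogonal_to_span[OF that, of "D x"] by (auto simp: orthogonal_def)
    qed
    ultimately show ?case
      by (metis imageI inner_commute span_base)
  qed
  ultimately show ?thesis by blast
qed

section \<open>Minimizers of penalized problems\<close>

text \<open>Tychonoff's theorem; it is used both for the auxiliary points \<open>P\<close> of the penalty method and for normalized
multipliers.\<close>

lemma compact_function_box:
  fixes c :: "'i::countable \<Rightarrow> real"
  shows "compact {P. \<forall>a. \<bar>P a\<bar> \<le> c a}"
proof -
  have "{P. \<forall>a. \<bar>P a\<bar> \<le> c a} = PiE UNIV (\<lambda>a. {- c a..c a})"
    unfolding PiE_UNIV_domain by (auto simp: Pi_iff abs_le_iff minus_le_iff)
  moreover have "compactin (product_topology (\<lambda>a. euclidean) UNIV) (PiE UNIV (\<lambda>a. {- c a..c a}))"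
    by (simp add: compactin_PiE)
  ultimately show ?thesis
    by (simp add: euclidean_product_topology)
qed

lemma tendsto_function_coordinate:
  "(P \<longlongrightarrow> Q) F \<Longrightarrow> ((\<lambda>k. P k a) \<longlongrightarrow> Q a) F"
  for P :: "'k \<Rightarrow> 'i \<Rightarrow> 'b::topological_space"
  by (rule continuous_on_tendsto_compose[OF continuous_on_product_coordinates]) auto

text \<open>The minimizers exist because \<open>P\<close> is confined to a box, which makes the feasible set compact. Comparison with
the value \<open>f xs\<close> at \<open>(xs, 0)\<close> forces \<open>G(x\<^sub>k) - P\<^sub>k\<close> to \<open>0\<close>, so that a cluster point \<open>x\<close> satisfies \<open>G(x) \<in> Q\<close> and
hence \<open>f x \<ge> f xs\<close>; the quartic term then leaves only \<open>x = xs\<close>. Consequently \<open>P\<^sub>k \<rightarrow> G(xs) = 0\<close>, and the box is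
eventually not active.\<close>

lemma penalty_minimizers:
  fixes f :: "'a::euclidean_space \<Rightarrow> real" and G :: "'i::countable \<Rightarrow> 'a \<Rightarrow> real"
  assumes "finite A"
    and f: "continuous_on (cball xs r) f" and G: "\<And>a. a \<in> A \<Longrightarrow> continuous_on (cball xs r) (G a)"
    and "r > 0" and Q: "closed Q" "(\<lambda>_. 0) \<in> Q" "\<forall>P\<in>Q. \<forall>a. a \<notin> A \<longrightarrow> P a = 0"
    and G0: "\<And>a. a \<in> A \<Longrightarrow> G a xs = 0"
    and min: "\<And>x. x \<in> cball xs r \<Longrightarrow> (\<lambda>a. if a \<in> A then G a x else 0) \<in> Q \<Longrightarrow> f xs \<le> f x"
  defines "\<Phi> \<equiv> \<lambda>\<rho> x P. f x + 1/2 * ((x - xs) \<bullet> (x - xs))\<^sup>2 + (\<Sum>a\<in>A. \<rho>/2 * (G a x - P a)\<^sup>2)"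
  obtains x :: "nat \<Rightarrow> 'a" and P :: "nat \<Rightarrow> 'i \<Rightarrow> real" and \<rho> :: "nat \<Rightarrow> real"
    where "x \<longlonglongrightarrow> xs" "\<And>a. a \<in> A \<Longrightarrow> (\<lambda>k. P k a) \<longlonglongrightarrow> 0" "\<And>k. P k \<in> Q" "\<And>k. \<rho> k > 0"
      "\<And>k y R. y \<in> cball xs r \<Longrightarrow> R \<in> Q \<Longrightarrow> (\<forall>a\<in>A. \<bar>R a\<bar> \<le> 1) \<Longrightarrow> \<Phi> (\<rho> k) (x k) (P k) \<le> \<Phi> (\<rho> k) y R"
proof -
  define box where "box = Q \<inter> {P. \<forall>a. \<bar>P a\<bar> \<le> (if a \<in> A then 1 else 0)}"
  define C where "C = cball xs r \<times> box"
  have "compact C"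
    unfolding C_def box_def using Q(1) by (intro compact_Times closed_Int_compact compact_function_box) auto
  have mem: "(y, R) \<in> C" if "y \<in> cball xs r" "R \<in> Q" "\<forall>a\<in>A. \<bar>R a\<bar> \<le> 1" for y R
    using that Q(3) by (auto simp: C_def box_def)
  have base: "(xs, \<lambda>_. 0) \<in> C" using \<open>r > 0\<close> Q(2) by (intro mem) auto
  have fC: "continuous_on C (\<lambda>z. f (fst z))"
    by (rule continuous_on_compose2[OF f continuous_on_fst[OF continuous_on_id]]) (auto simp: C_def)
  have GC: "continuous_on C (\<lambda>z. G a (fst z) - snd z a)" if "a \<in> A" for a
  proof (rule continuous_on_diff)
    show "continuous_on C (\<lambda>z. G a (fst z))"
      by (rule continuous_on_compose2[OF G[OF that] continuous_on_fst[OF continuous_on_id]]) (auto simp: C_def)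
    show "continuous_on C (\<lambda>z. snd z a)"
      by (rule continuous_on_compose2[OF continuous_on_product_coordinates continuous_on_snd[OF continuous_on_id]]) auto
  qed
  have "\<exists>z\<in>C. \<forall>w\<in>C. \<Phi> \<rho> (fst z) (snd z) \<le> \<Phi> \<rho> (fst w) (snd w)" for \<rho>
  proof (rule continuous_attains_inf[OF \<open>compact C\<close>])
    show "continuous_on C (\<lambda>z. \<Phi> \<rho> (fst z) (snd z))"
      unfolding \<Phi>_def by (intro continuous_intros fC GC)
  qed (use base in auto)
  then have "\<forall>k. \<exists>z. z \<in> C \<and> (\<forall>w\<in>C. \<Phi> (real (Suc k)) (fst z) (snd z) \<le> \<Phi> (real (Suc k)) (fst w) (snd w))"
    by blast
  then obtain z where z: "\<And>k. z k \<in> C"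
    "\<And>k w. w \<in> C \<Longrightarrow> \<Phi> (real (Suc k)) (fst (z k)) (snd (z k)) \<le> \<Phi> (real (Suc k)) (fst w) (snd w)"
    using choice[of "\<lambda>k z. z \<in> C \<and> (\<forall>w\<in>C. \<Phi> (real (Suc k)) (fst z) (snd z) \<le> \<Phi> (real (Suc k)) (fst w) (snd w))"]
    by blast
  obtain lim s where lim: "lim \<in> C" "strict_mono s" "(z \<circ> s) \<longlonglongrightarrow> lim"
    using compact_imp_seq_compact[OF \<open>compact C\<close>] z(1) unfolding seq_compact_def by metis
  define x P where "x = (\<lambda>k. fst (z (s k)))" and "P = (\<lambda>k. snd (z (s k)))"
  define \<rho> where "\<rho> k = real (Suc (s k))" for k
  have xP: "x k \<in> cball xs r" "P k \<in> Q" for k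
    using z(1)[of "s k"] by (auto simp: x_def P_def C_def box_def)
  have opt: "\<Phi> (\<rho> k) (x k) (P k) \<le> \<Phi> (\<rho> k) y R"
    if "y \<in> cball xs r" "R \<in> Q" "\<forall>a\<in>A. \<bar>R a\<bar> \<le> 1" for k y R
    using z(2)[OF mem[OF that]] by (simp add: x_def P_def \<rho>_def)
  have x_lim: "x \<longlonglongrightarrow> fst lim" and P_fun: "P \<longlonglongrightarrow> snd lim"
    using tendsto_fst[OF lim(3)] tendsto_snd[OF lim(3)] by (simp_all add: x_def P_def o_def)
  have P_lim: "(\<lambda>k. P k a) \<longlonglongrightarrow> snd lim a" for a
    by (rule tendsto_function_coordinate[OF P_fun])
  have lim_mem: "fst lim \<in> cball xs r" "snd lim \<in> Q"
    using lim(1) by (auto simp: C_def box_def)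
  have f_lim: "(\<lambda>k. f (x k)) \<longlonglongrightarrow> f (fst lim)"
    using continuous_on_tendsto_compose[OF f x_lim lim_mem(1)] xP(1) by simp
  have G_lim: "(\<lambda>k. G a (x k)) \<longlonglongrightarrow> G a (fst lim)" if "a \<in> A" for a
    using continuous_on_tendsto_compose[OF G[OF that] x_lim lim_mem(1)] xP(1) by simp
  have at_xs: "\<Phi> (\<rho> k) (x k) (P k) \<le> f xs" for k
    using opt[of xs "\<lambda>_. 0" k] \<open>r > 0\<close> Q(2) G0 by (simp add: \<Phi>_def)
  define q where "q y = 1/2 * ((y - xs) \<bullet> (y - xs))\<^sup>2" for y
  \<comment> \<open>The squared residual, which the growing penalty parameter forces to zero.\<close>
  define V where "V k = (\<Sum>a\<in>A. (G a (x k) - P k a)\<^sup>2)" for k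
  have V0: "V k \<ge> 0" for k unfolding V_def by (intro sum_nonneg) simp
  have val: "f (x k) + q (x k) + \<rho> k / 2 * V k \<le> f xs" for k
    using at_xs[of k] by (simp add: \<Phi>_def q_def V_def sum_distrib_left)
  have \<rho>0: "\<rho> k > 0" for k by (simp add: \<rho>_def)
  have "f (fst lim) + q (fst lim) \<le> f xs"
  proof (rule LIMSEQ_le_const2)
    show "(\<lambda>k. f (x k) + q (x k)) \<longlonglongrightarrow> f (fst lim) + q (fst lim)"
      unfolding q_def by (intro tendsto_intros f_lim x_lim)
    show "\<exists>N. \<forall>k\<ge>N. f (x k) + q (x k) \<le> f xs"
    proof (intro exI allI impI)
      fix k have "\<rho> k / 2 * V k \<ge> 0" using \<rho>0[of k] V0[of k] by simp
      then show "f (x k) + q (x k) \<le> f xs" using val[of k] by linarith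
    qed
  qed
  moreover have lim_eq: "\<forall>a\<in>A. G a (fst lim) = snd lim a"
  proof -
    have "V \<longlonglongrightarrow> (\<Sum>a\<in>A. (G a (fst lim) - snd lim a)\<^sup>2)"
      unfolding V_def by (intro tendsto_intros G_lim P_lim)
    moreover have "V \<longlonglongrightarrow> 0"
    proof (rule tendsto_sandwich[of "\<lambda>_. 0"])
      show "eventually (\<lambda>k. V k \<le> 2 * inverse (\<rho> k) * (f xs - f (x k))) sequentially"
      proof (intro always_eventually allI)
        fix k
        have "q (x k) \<ge> 0" by (simp add: q_def)
        then have "\<rho> k / 2 * V k \<le> f xs - f (x k)" using val[of k] by linarith
        then show "V k \<le> 2 * inverse (\<rho> k) * (f xs - f (x k))"
          using \<rho>0[of k] by (simp add: field_simps)
      qed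
      have "(\<lambda>k. inverse (\<rho> k)) \<longlonglongrightarrow> 0"
        using LIMSEQ_subseq_LIMSEQ[OF LIMSEQ_inverse_real_of_nat lim(2)] by (simp add: o_def \<rho>_def)
      then have "(\<lambda>k. 2 * inverse (\<rho> k) * (f xs - f (x k))) \<longlonglongrightarrow> 2 * 0 * (f xs - f (fst lim))"
        by (intro tendsto_intros f_lim)
      then show "(\<lambda>k. 2 * inverse (\<rho> k) * (f xs - f (x k))) \<longlonglongrightarrow> 0" by simp
    qed (use V0 in auto)
    ultimately have "(\<Sum>a\<in>A. (G a (fst lim) - snd lim a)\<^sup>2) = 0"
      using LIMSEQ_unique by blast
    then show ?thesis
      using \<open>finite A\<close> by (simp add: sum_nonneg_eq_0_iff)
  qed
  moreover have "f xs \<le> f (fst lim)"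
  proof (rule min[OF lim_mem(1)])
    have "(\<lambda>a. if a \<in> A then G a (fst lim) else 0) = snd lim"
      using Q(3) lim_mem(2) lim_eq by auto
    then show "(\<lambda>a. if a \<in> A then G a (fst lim) else 0) \<in> Q"
      using lim_mem(2) by simp
  qed
  ultimately have "q (fst lim) \<le> 0" by linarith
  then have lim_xs: "fst lim = xs" by (simp add: q_def)
  show thesis
  proof (rule that[of x P \<rho>])
    show "x \<longlonglongrightarrow> xs" using x_lim lim_xs by simp
    show "(\<lambda>k. P k a) \<longlonglongrightarrow> 0" if "a \<in> A" for a
      using P_lim[of a] lim_eq G0[OF that] lim_xs that by simp
  qed (use xP(2) \<rho>0 opt in auto)
qed

text \<open>First-order optimality in \<open>P\<close>: moving from \<open>P\<close> to \<open>P + t R\<close> changes the penalty by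
\<open>-t (\<Sum>a. \<rho> (y a - P a) R a) + O(t\<^sup>2)\<close>, which cannot be negative for small \<open>t > 0\<close>.\<close>

lemma polar_of_penalty_residual:
  fixes R :: "'i \<Rightarrow> real"
  assumes "finite A" "\<rho> > 0" and P: "\<And>a. a \<in> A \<Longrightarrow> \<bar>P a\<bar> < 1"
    and opt: "\<And>t. t > 0 \<Longrightarrow> \<forall>a\<in>A. \<bar>P a + t * R a\<bar> \<le> 1 \<Longrightarrow>
      (\<Sum>a\<in>A. \<rho>/2 * (y a - P a)\<^sup>2) \<le> (\<Sum>a\<in>A. \<rho>/2 * (y a - (P a + t * R a))\<^sup>2)"
  shows "(\<Sum>a\<in>A. \<rho> * (y a - P a) * R a) \<le> 0"
proof -
  define M where "M = (\<Sum>a\<in>A. \<rho>/2 * (R a)\<^sup>2)"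
  have "((\<lambda>t. \<bar>P a + t * R a\<bar>) \<longlongrightarrow> \<bar>P a + 0 * R a\<bar>) (at_right 0)" for a
    by (intro tendsto_intros)
  then have "eventually (\<lambda>t. \<forall>a\<in>A. \<bar>P a + t * R a\<bar> < 1) (at_right 0)"
    using P order_tendstoD(2) by (fastforce intro!: eventually_ball_finite[OF \<open>finite A\<close>])
  moreover have "eventually (\<lambda>t. t > 0) (at_right (0::real))"
    by (simp add: eventually_at_right_less)
  ultimately have "eventually (\<lambda>t. (\<Sum>a\<in>A. \<rho> * (y a - P a) * R a) \<le> t * M) (at_right 0)"
  proof eventually_elim
    case (elim t)
    have "(\<Sum>a\<in>A. \<rho>/2 * (y a - (P a + t * R a))\<^sup>2)
        = (\<Sum>a\<in>A. \<rho>/2 * (y a - P a)\<^sup>2) - t * (\<Sum>a\<in>A. \<rho> * (y a - P a) * R a) + t * (t * M)"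
      unfolding M_def sum_distrib_left sum_subtractf[symmetric] sum.distrib[symmetric]
      by (intro sum.cong) (auto simp: power2_eq_square field_simps)
    moreover have "\<forall>a\<in>A. \<bar>P a + t * R a\<bar> \<le> 1"
      using elim(1) by (simp add: less_imp_le)
    ultimately have "t * (\<Sum>a\<in>A. \<rho> * (y a - P a) * R a) \<le> t * (t * M)"
      using opt[OF elim(2)] by linarith
    then show ?case using elim(2) by simp
  qed
  moreover have "((\<lambda>t. t * M) \<longlongrightarrow> 0 * M) (at_right 0)"
    by (intro tendsto_intros)
  ultimately show ?thesis
    using tendsto_lowerbound[of "\<lambda>t. t * M" "0 * M" "at_right 0"] by simp
qed

section \<open>Second-order necessary conditions under constant rank\<close>

text \<open>Dividing by \<open>n = 1 + \<parallel>\<eta>\<parallel>\<^sub>1\<close> instead of \<open>\<parallel>\<eta>\<parallel>\<^sub>1\<close> avoids a case distinction: \<open>\<eta>/n\<close> lies in a compact box and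
\<open>1/n = 1 - \<parallel>\<eta>/n\<parallel>\<^sub>1\<close> converges along with it, to \<open>\<alpha>\<close> say. If \<open>\<alpha>\<close> were zero, then the limit \<open>b\<close> of \<open>\<eta>/n\<close> would be
an element of the polar cone that annihilates the gradients, hence \<open>b = 0\<close> and \<open>\<alpha> = 1\<close>. So \<open>\<alpha> > 0\<close> and
\<open>\<eta> = (\<eta>/n)/(1/n)\<close> converges to \<open>b/\<alpha>\<close>.\<close>

lemma bounded_multipliers:
  fixes G' :: "'i::countable \<Rightarrow> 'a::real_normed_vector" and \<eta> :: "nat \<Rightarrow> 'i \<Rightarrow> real"
  assumes "finite A" and e: "e \<longlonglongrightarrow> e0"
    and v: "\<And>a. a \<in> A \<Longrightarrow> v a \<longlonglongrightarrow> G' a"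
    and eq: "eventually (\<lambda>k. e k + (\<Sum>a\<in>A. \<eta> k a *\<^sub>R v a k) = 0) sequentially"
    and polar: "eventually (\<lambda>k. \<forall>R\<in>Q. (\<Sum>a\<in>A. \<eta> k a * R a) \<le> 0) sequentially"
    and cq: "\<And>\<nu>. \<forall>R\<in>Q. (\<Sum>a\<in>A. \<nu> a * R a) \<le> 0 \<Longrightarrow> (\<Sum>a\<in>A. \<nu> a *\<^sub>R G' a) = 0 \<Longrightarrow> \<forall>a\<in>A. \<nu> a = 0"
  obtains s \<nu> where "strict_mono (s :: nat \<Rightarrow> nat)" "\<And>a. a \<in> A \<Longrightarrow> (\<lambda>k. \<eta> (s k) a) \<longlonglongrightarrow> \<nu> a"
proof -
  define n where "n k = 1 + (\<Sum>a\<in>A. \<bar>\<eta> k a\<bar>)" for k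
  have n: "n k \<ge> 1" for k unfolding n_def by (simp add: sum_nonneg)
  then have n0: "n k > 0" "n k \<noteq> 0" for k
    using less_le_trans[OF zero_less_one n[of k]] by simp_all
  define \<beta> where "\<beta> k a = (if a \<in> A then \<eta> k a / n k else 0)" for k a
  have "\<bar>\<beta> k a\<bar> \<le> 1" for k a
  proof (cases "a \<in> A")
    case True
    then have "\<bar>\<eta> k a\<bar> \<le> (\<Sum>a\<in>A. \<bar>\<eta> k a\<bar>)"
      using \<open>finite A\<close> by (intro member_le_sum) auto
    then have "\<bar>\<eta> k a\<bar> \<le> n k" by (simp add: n_def)
    then show ?thesis using n0[of k] by (simp add: \<beta>_def abs_divide)
  qed (simp add: \<beta>_def)
  then have "\<beta> k \<in> {P. \<forall>a. \<bar>P a\<bar> \<le> 1}" for k by simp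
  with compact_imp_seq_compact[OF compact_function_box[of "\<lambda>_. 1"]]
  obtain b s where s: "strict_mono s" and \<beta>: "(\<beta> \<circ> s) \<longlonglongrightarrow> b"
    unfolding seq_compact_def by metis
  have b: "(\<lambda>k. \<beta> (s k) a) \<longlonglongrightarrow> b a" for a
    using tendsto_function_coordinate[OF \<beta>] by (simp add: o_def)
  define \<alpha> where "\<alpha> = 1 - (\<Sum>a\<in>A. \<bar>b a\<bar>)"
  have "1 / n k = 1 - (\<Sum>a\<in>A. \<bar>\<beta> k a\<bar>)" for k
  proof -
    have "(\<Sum>a\<in>A. \<bar>\<beta> k a\<bar>) = (\<Sum>a\<in>A. \<bar>\<eta> k a\<bar>) / n k"
      using n0[of k] by (simp add: \<beta>_def abs_divide sum_divide_distrib)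
    also have "\<dots> = 1 - 1 / n k" using n0[of k] by (simp add: n_def field_simps)
    finally show ?thesis by simp
  qed
  then have \<alpha>: "(\<lambda>k. 1 / n (s k)) \<longlonglongrightarrow> \<alpha>"
    unfolding \<alpha>_def by (auto intro!: tendsto_intros b)
  have "\<alpha> \<ge> 0" by (rule LIMSEQ_le_const[OF \<alpha>]) (simp add: n0(1) less_imp_le)
  have sub: "eventually (\<lambda>k. P (s k)) sequentially" if "eventually P sequentially" for P
    using eventually_subseq[OF s that] .
  have "\<forall>R\<in>Q. (\<Sum>a\<in>A. b a * R a) \<le> 0"
  proof
    fix R assume "R \<in> Q"
    show "(\<Sum>a\<in>A. b a * R a) \<le> 0"
    proof (rule tendsto_upperbound)
      show "(\<lambda>k. \<Sum>a\<in>A. \<beta> (s k) a * R a) \<longlonglongrightarrow> (\<Sum>a\<in>A. b a * R a)"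
        by (intro tendsto_intros b)
      show "eventually (\<lambda>k. (\<Sum>a\<in>A. \<beta> (s k) a * R a) \<le> 0) sequentially"
        using sub[OF polar]
      proof eventually_elim
        case (elim k)
        have "(\<Sum>a\<in>A. \<beta> (s k) a * R a) = (\<Sum>a\<in>A. \<eta> (s k) a * R a) / n (s k)"
          unfolding sum_divide_distrib by (intro sum.cong) (auto simp: \<beta>_def)
        with elim \<open>R \<in> Q\<close> n0[of "s k"] show ?case by (simp add: divide_le_0_iff)
      qed
    qed simp
  qed
  moreover have lim_eq: "\<alpha> *\<^sub>R e0 + (\<Sum>a\<in>A. b a *\<^sub>R G' a) = 0"
  proof (rule LIMSEQ_unique)
    show "(\<lambda>k. (1 / n (s k)) *\<^sub>R e (s k) + (\<Sum>a\<in>A. \<beta> (s k) a *\<^sub>R v a (s k)))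
        \<longlonglongrightarrow> \<alpha> *\<^sub>R e0 + (\<Sum>a\<in>A. b a *\<^sub>R G' a)"
      using LIMSEQ_subseq_LIMSEQ[OF e s] LIMSEQ_subseq_LIMSEQ[OF v s]
      by (intro tendsto_intros \<alpha> b) (auto simp: o_def)
    have "eventually (\<lambda>k. (1 / n (s k)) *\<^sub>R e (s k) + (\<Sum>a\<in>A. \<beta> (s k) a *\<^sub>R v a (s k)) = 0) sequentially"
      using sub[OF eq]
    proof eventually_elim
      case (elim k)
      have "(1 / n (s k)) *\<^sub>R e (s k) + (\<Sum>a\<in>A. \<beta> (s k) a *\<^sub>R v a (s k))
          = (1 / n (s k)) *\<^sub>R (e (s k) + (\<Sum>a\<in>A. \<eta> (s k) a *\<^sub>R v a (s k)))"
        by (simp add: scaleR_add_right scaleR_sum_right \<beta>_def)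
      then show ?case using elim by simp
    qed
    then show "(\<lambda>k. (1 / n (s k)) *\<^sub>R e (s k) + (\<Sum>a\<in>A. \<beta> (s k) a *\<^sub>R v a (s k))) \<longlonglongrightarrow> 0"
      by (rule tendsto_eventually)
  qed
  ultimately have "\<alpha> \<noteq> 0" using cq[of b] by (auto simp: \<alpha>_def)
  show thesis
  proof (rule that[OF s, of "\<lambda>a. b a / \<alpha>"])
    fix a assume "a \<in> A"
    have "(\<lambda>k. \<beta> (s k) a / (1 / n (s k))) \<longlonglongrightarrow> b a / \<alpha>"
      using \<open>\<alpha> \<noteq> 0\<close> by (intro tendsto_intros b \<alpha>)
    then show "(\<lambda>k. \<eta> (s k) a) \<longlonglongrightarrow> b a / \<alpha>"
      using n0 \<open>a \<in> A\<close> by (simp add: \<beta>_def)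
  qed
qed

text \<open>The general result behind the theorem. The constraint is \<open>G(x) \<in> Q\<close> for a closed convex cone \<open>Q\<close>, and
\<open>G(xs) = 0\<close> is the vertex of that cone; this is why the polar cone of \<open>Q\<close> itself, rather than a normal cone at some
other point, contains the multipliers. The assumption \<open>cq\<close> is the dual form of Robinson's condition.\<close>

theorem constant_rank_second_order_necessary:
  fixes f :: "'a::euclidean_space \<Rightarrow> real" and G :: "'i::countable \<Rightarrow> 'a \<Rightarrow> real"
  assumes "finite A" and U: "open U" "xs \<in> U"
    and f: "C2_on U f f' f''" and G: "\<And>a. a \<in> A \<Longrightarrow> C2_on U (G a) (G' a) (G'' a)"
    and Q: "closed Q" "(\<lambda>_. 0) \<in> Q" "\<forall>P\<in>Q. \<forall>a. a \<notin> A \<longrightarrow> P a = 0"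
    and cone: "\<And>P R t. P \<in> Q \<Longrightarrow> R \<in> Q \<Longrightarrow> t > 0 \<Longrightarrow> (\<lambda>a. P a + t * R a) \<in> Q"
    and G0: "\<And>a. a \<in> A \<Longrightarrow> G a xs = 0"
    and min: "\<And>x. x \<in> U \<Longrightarrow> (\<lambda>a. if a \<in> A then G a x else 0) \<in> Q \<Longrightarrow> f xs \<le> f x"
    and cq: "\<And>\<nu>. \<forall>R\<in>Q. (\<Sum>a\<in>A. \<nu> a * R a) \<le> 0 \<Longrightarrow> (\<Sum>a\<in>A. \<nu> a *\<^sub>R G' a xs) = 0 \<Longrightarrow> \<forall>a\<in>A. \<nu> a = 0"
    and rank: "eventually (\<lambda>x. dim ((\<lambda>a. G' a x) ` A) = dim ((\<lambda>a. G' a xs) ` A)) (nhds xs)"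
  obtains \<nu> where "\<And>R. R \<in> Q \<Longrightarrow> (\<Sum>a\<in>A. \<nu> a * R a) \<le> 0"
    "f' xs + (\<Sum>a\<in>A. \<nu> a *\<^sub>R G' a xs) = 0"
    "\<And>d. \<forall>a\<in>A. G' a xs \<bullet> d = 0 \<Longrightarrow> d \<bullet> f'' xs d + (\<Sum>a\<in>A. \<nu> a * (d \<bullet> G'' a xs d)) \<ge> 0"
proof -
  obtain r where r: "r > 0" "cball xs r \<subseteq> U"
    using U open_contains_cball by blast
  define q' where "q' y = (2 * ((y - xs) \<bullet> (y - xs))) *\<^sub>R (y - xs)" for y
  define q'' where "q'' y v = (2 * ((y - xs) \<bullet> (y - xs))) *\<^sub>R v + (4 * (v \<bullet> (y - xs))) *\<^sub>R (y - xs)" for y v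
  have q: "C2_on V (\<lambda>y. 1/2 * ((y - xs) \<bullet> (y - xs))\<^sup>2) q' q''" for V
    unfolding q'_def q''_def by (rule C2_on_quartic)
  have cont: "continuous_on (cball xs r) \<phi>" if "C2_on U \<phi> \<phi>' \<phi>''" for \<phi> :: "'a \<Rightarrow> real" and \<phi>' \<phi>''
    using C2_onD(5)[OF that] r(2) by (auto intro: continuous_at_imp_continuous_on)
  have min_ball: "f xs \<le> f y" if "y \<in> cball xs r" "(\<lambda>a. if a \<in> A then G a y else 0) \<in> Q" for y
    using min[of y] that r(2) by blast
  obtain x P \<rho> where x: "x \<longlonglongrightarrow> xs" and P: "\<And>a. a \<in> A \<Longrightarrow> (\<lambda>k. P k a) \<longlonglongrightarrow> 0" "\<And>k. P k \<in> Q"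
    and \<rho>: "\<And>k. \<rho> k > (0::real)"
    and opt: "\<And>k y R. y \<in> cball xs r \<Longrightarrow> R \<in> Q \<Longrightarrow> (\<forall>a\<in>A. \<bar>R a\<bar> \<le> 1) \<Longrightarrow>
      f (x k) + 1/2 * ((x k - xs) \<bullet> (x k - xs))\<^sup>2 + (\<Sum>a\<in>A. \<rho> k/2 * (G a (x k) - P k a)\<^sup>2)
      \<le> f y + 1/2 * ((y - xs) \<bullet> (y - xs))\<^sup>2 + (\<Sum>a\<in>A. \<rho> k/2 * (G a y - R a)\<^sup>2)"
    using penalty_minimizers[where A = A and xs = xs and r = r and f = f and G = G and Q = Q,
        OF \<open>finite A\<close> cont[OF f] cont[OF G] r(1) Q G0 min_ball] by blast
  \<comment> \<open>The derivative of the penalty with respect to the value of the constraint.\<close>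
  define \<eta> where "\<eta> k a = \<rho> k * (G a (x k) - P k a)" for k a
  have "eventually (\<lambda>k. \<bar>P k a\<bar> < 1) sequentially" if "a \<in> A" for a
    using order_tendstoD(2)[OF tendsto_rabs[OF P(1)[OF that]], of 1] by simp
  then have "eventually (\<lambda>k. \<forall>a\<in>A. \<bar>P k a\<bar> < 1) sequentially"
    using \<open>finite A\<close> by (simp add: eventually_ball_finite)
  moreover have "eventually (\<lambda>k. x k \<in> ball xs r) sequentially"
    using x r(1) by (intro topological_tendstoD) auto
  ultimately have ev: "eventually (\<lambda>k. (f' (x k) + q' (x k)) + (\<Sum>a\<in>A. \<eta> k a *\<^sub>R G' a (x k)) = 0 \<and>
      (\<forall>R\<in>Q. (\<Sum>a\<in>A. \<eta> k a * R a) \<le> 0) \<and>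
      (\<forall>d. (\<forall>a\<in>A. G' a (x k) \<bullet> d = 0) \<longrightarrow>
        d \<bullet> f'' (x k) d + d \<bullet> q'' (x k) d + (\<Sum>a\<in>A. \<eta> k a * (d \<bullet> G'' a (x k) d)) \<ge> 0)) sequentially"
  proof eventually_elim
    case (elim k)
    have "ball xs r \<subseteq> U" using r(2) ball_subset_cball by blast
    note F = C2_on_add[OF C2_on_add[OF C2_on_subset[OF f this] q]
      C2_on_sum[where A = A, OF C2_on_square[where c = "\<rho> k" and t = "P k a" for a,
        OF C2_on_subset[OF G \<open>ball xs r \<subseteq> U\<close>]]]]
    note nec = C2_on_second_order_necessary[OF F open_ball elim(2)]
    have mini: "f (x k) + 1/2 * ((x k - xs) \<bullet> (x k - xs))\<^sup>2 + (\<Sum>a\<in>A. \<rho> k/2 * (G a (x k) - P k a)\<^sup>2)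
      \<le> f y + 1/2 * ((y - xs) \<bullet> (y - xs))\<^sup>2 + (\<Sum>a\<in>A. \<rho> k/2 * (G a y - P k a)\<^sup>2)" if "y \<in> ball xs r" for y
      using opt[of y "P k" k] that P(2) elim(1) by (auto simp: less_imp_le)
    have "(f' (x k) + q' (x k)) + (\<Sum>a\<in>A. \<eta> k a *\<^sub>R G' a (x k)) = 0"
      using nec(1)[OF _ mini] by (simp add: \<eta>_def)
    moreover have "(\<Sum>a\<in>A. \<eta> k a * R a) \<le> 0" if "R \<in> Q" for R
      unfolding \<eta>_def
    proof (rule polar_of_penalty_residual[OF \<open>finite A\<close> \<rho>])
      fix t :: real assume "t > 0" "\<forall>a\<in>A. \<bar>P k a + t * R a\<bar> \<le> 1"
      then show "(\<Sum>a\<in>A. \<rho> k / 2 * (G a (x k) - P k a)\<^sup>2)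
          \<le> (\<Sum>a\<in>A. \<rho> k / 2 * (G a (x k) - (P k a + t * R a))\<^sup>2)"
        using opt[of "x k" "\<lambda>a. P k a + t * R a" k] elim(2) cone[OF P(2) that] by auto
    qed (use elim(1) in auto)
    moreover have "d \<bullet> f'' (x k) d + d \<bullet> q'' (x k) d + (\<Sum>a\<in>A. \<eta> k a * (d \<bullet> G'' a (x k) d)) \<ge> 0"
      if "\<forall>a\<in>A. G' a (x k) \<bullet> d = 0" for d
      using nec(2)[OF _ mini, of d] that
      by (simp add: inner_add_right inner_sum_right \<eta>_def inner_commute)
    ultimately show ?case by blast
  qed
  have f'_lim: "(\<lambda>k. f' (x k) + q' (x k)) \<longlonglongrightarrow> f' xs + q' xs"
    by (intro tendsto_add isCont_tendsto_compose[OF _ x] C2_onD(6)[OF f U(2)] C2_onD(6)[OF q UNIV_I])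
  have G'_lim: "(\<lambda>k. G' a (x k)) \<longlonglongrightarrow> G' a xs" if "a \<in> A" for a
    by (intro isCont_tendsto_compose[OF _ x] C2_onD(6)[OF G[OF that] U(2)])
  obtain s \<nu> where s: "strict_mono s" and \<nu>: "\<And>a. a \<in> A \<Longrightarrow> (\<lambda>k. \<eta> (s k) a) \<longlonglongrightarrow> \<nu> a"
    by (rule bounded_multipliers[OF \<open>finite A\<close> f'_lim G'_lim _ _ cq, where \<eta> = \<eta> and Q = Q])
      (use ev in \<open>auto elim: eventually_mono\<close>)
  note ev = eventually_subseq[OF s ev]
  have xs: "(\<lambda>k. x (s k)) \<longlonglongrightarrow> xs" using LIMSEQ_subseq_LIMSEQ[OF x s] by (simp add: o_def)
  have q0: "q' xs = 0" "q'' xs d = 0" for d by (simp_all add: q'_def q''_def)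
  show thesis
  proof (rule that[of \<nu>])
    fix R assume "R \<in> Q"
    show "(\<Sum>a\<in>A. \<nu> a * R a) \<le> 0"
    proof (rule tendsto_upperbound)
      show "(\<lambda>k. \<Sum>a\<in>A. \<eta> (s k) a * R a) \<longlonglongrightarrow> (\<Sum>a\<in>A. \<nu> a * R a)"
        by (intro tendsto_intros \<nu>)
      show "eventually (\<lambda>k. (\<Sum>a\<in>A. \<eta> (s k) a * R a) \<le> 0) sequentially"
        using ev \<open>R \<in> Q\<close> by (auto elim: eventually_mono)
    qed simp
  next
    have "(\<lambda>k. (f' (x (s k)) + q' (x (s k))) + (\<Sum>a\<in>A. \<eta> (s k) a *\<^sub>R G' a (x (s k))))
        \<longlonglongrightarrow> (f' xs + q' xs) + (\<Sum>a\<in>A. \<nu> a *\<^sub>R G' a xs)"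
      by (rule tendsto_add, use LIMSEQ_subseq_LIMSEQ[OF f'_lim s] in \<open>simp add: o_def\<close>)
        (auto intro!: tendsto_intros \<nu> LIMSEQ_subseq_LIMSEQ[OF G'_lim s, unfolded o_def])
    moreover have "(\<lambda>k. (f' (x (s k)) + q' (x (s k))) + (\<Sum>a\<in>A. \<eta> (s k) a *\<^sub>R G' a (x (s k)))) \<longlonglongrightarrow> 0"
      using ev by (intro tendsto_eventually) (auto elim: eventually_mono)
    ultimately show "f' xs + (\<Sum>a\<in>A. \<nu> a *\<^sub>R G' a xs) = 0"
      using LIMSEQ_unique q0 by fastforce
  next
    fix d assume d: "\<forall>a\<in>A. G' a xs \<bullet> d = 0"
    \<comment> \<open>The second-order condition is available only for directions in the kernel at the minimizers.\<close>
    have "\<exists>D. (D \<longlongrightarrow> d) sequentially \<and> eventually (\<lambda>k. \<forall>a\<in>A. G' a (x (s k)) \<bullet> D k = 0) sequentially"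
    proof (rule kernel_of_constant_rank_family[OF \<open>finite A\<close>])
      show "(\<lambda>k. G' a (x (s k))) \<longlonglongrightarrow> G' a xs" if "a \<in> A" for a
        using LIMSEQ_subseq_LIMSEQ[OF G'_lim[OF that] s] by (simp add: o_def)
      show "eventually (\<lambda>k. dim ((\<lambda>a. G' a (x (s k))) ` A) = dim ((\<lambda>a. G' a xs) ` A)) sequentially"
        using eventually_compose_filterlim[OF rank xs] .
    qed (use d in auto)
    then obtain D where D: "D \<longlonglongrightarrow> d" "eventually (\<lambda>k. \<forall>a\<in>A. G' a (x (s k)) \<bullet> D k = 0) sequentially"
      by blast
    have "d \<bullet> f'' xs d + d \<bullet> q'' xs d + (\<Sum>a\<in>A. \<nu> a * (d \<bullet> G'' a xs d)) \<ge> 0"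
    proof (rule tendsto_lowerbound)
      show "(\<lambda>k. D k \<bullet> f'' (x (s k)) (D k) + D k \<bullet> q'' (x (s k)) (D k)
            + (\<Sum>a\<in>A. \<eta> (s k) a * (D k \<bullet> G'' a (x (s k)) (D k))))
          \<longlonglongrightarrow> d \<bullet> f'' xs d + d \<bullet> q'' xs d + (\<Sum>a\<in>A. \<nu> a * (d \<bullet> G'' a xs d))"
        by (intro tendsto_add tendsto_sum tendsto_mult \<nu> C2_on_tendsto[OF f U(2,1) xs D(1)]
            C2_on_tendsto[OF q UNIV_I open_UNIV xs D(1)] C2_on_tendsto[OF G U(2,1) xs D(1)])
      show "eventually (\<lambda>k. 0 \<le> D k \<bullet> f'' (x (s k)) (D k) + D k \<bullet> q'' (x (s k)) (D k)
            + (\<Sum>a\<in>A. \<eta> (s k) a * (D k \<bullet> G'' a (x (s k)) (D k)))) sequentially"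
        using ev D(2) by eventually_elim blast
    qed simp
    then show "d \<bullet> f'' xs d + (\<Sum>a\<in>A. \<nu> a * (d \<bullet> G'' a xs d)) \<ge> 0"
      by (simp add: q0)
  qed
qed

section \<open>The second-order cone\<close>

lemma sum_lessThan_head: "m \<ge> 1 \<Longrightarrow> (\<Sum>j<m. F j) = F 0 + (\<Sum>j=1..<m. F j)"
  for F :: "nat \<Rightarrow> 'a::comm_monoid_add"
  by (simp add: lessThan_atLeast0 sum.atLeast_Suc_lessThan)

lemma tail_norm_nonneg [simp]: "0 \<le> tail_norm m w"
  by (simp add: tail_norm_def)

lemma tail_norm_eq_sqrt: "tail_norm m w = sqrt (\<Sum>j=1..<m. (w j)\<^sup>2)"
  by (simp add: tail_norm_def L2_set_def)

lemma tail_norm_power2: "(tail_norm m w)\<^sup>2 = (\<Sum>j=1..<m. w j * w j)"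
  by (simp add: tail_norm_eq_sqrt sum_nonneg power2_eq_square)

lemma tail_norm_eq_0: "tail_norm m w = 0 \<longleftrightarrow> (\<forall>j\<in>{1..<m}. w j = 0)"
  unfolding tail_norm_def by (rule L2_set_eq_0_iff) simp

lemma tail_norm_cong: "(\<And>j. 1 \<le> j \<Longrightarrow> j < m \<Longrightarrow> v j = w j) \<Longrightarrow> tail_norm m v = tail_norm m w"
  unfolding tail_norm_def by (rule L2_set_cong) auto

lemma tail_norm_add_scale:
  assumes "t \<ge> 0"
  shows "tail_norm m (\<lambda>j. v j + t * w j) \<le> tail_norm m v + t * tail_norm m w"
  using L2_set_triangle_ineq[of v "\<lambda>j. t * w j"] L2_set_right_distrib[OF assms, of w]
  by (simp add: tail_norm_def)

lemma tail_norm_minus: "tail_norm m (\<lambda>j. - w j) = tail_norm m w"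
  by (simp add: tail_norm_eq_sqrt)

lemma tail_norm_cauchy_schwarz:
  "\<bar>\<Sum>j=1..<m. v j * w j\<bar> \<le> tail_norm m v * tail_norm m w"
  using L2_set_mult_ineq[of v w "{1..<m}"] sum_abs[of "\<lambda>j. v j * w j" "{1..<m}"]
  by (simp add: tail_norm_def abs_mult)

lemma tail_norm_zero [simp]: "tail_norm m (\<lambda>_. 0) = 0"
  by (simp add: tail_norm_eq_0)

lemma tail_norm_scale: "t \<ge> 0 \<Longrightarrow> tail_norm m (\<lambda>j. t * w j) = t * tail_norm m w"
  by (simp add: tail_norm_def L2_set_right_distrib)

lemma tendsto_tail_norm:
  "(\<And>j. ((\<lambda>k. w k j) \<longlongrightarrow> w0 j) F) \<Longrightarrow> ((\<lambda>k. tail_norm m (w k)) \<longlongrightarrow> tail_norm m w0) F"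
  unfolding tail_norm_eq_sqrt by (intro tendsto_intros)

lemma continuous_on_tail_norm [continuous_intros]:
  "(\<And>j. continuous_on S (\<lambda>x. w x j)) \<Longrightarrow> continuous_on S (\<lambda>x. tail_norm m (w x))"
  unfolding tail_norm_eq_sqrt by (intro continuous_intros)

lemma Euclidean_space_eq_top_of_set: "Euclidean_space m = top_of_set {w. \<forall>j\<ge>m. w j = 0}"
  by (simp add: Euclidean_space_def euclidean_product_topology)

lemma mem_lorentz: "w \<in> lorentz m \<longleftrightarrow> (\<forall>j\<ge>m. w j = 0) \<and> tail_norm m w \<le> w 0"
  by (simp add: lorentz_def topspace_Euclidean_space)

text \<open>Lowering the first entry a little must not lead out of the cone.\<close>

lemma interior_point_of_lorentz:
  assumes "m \<ge> 1" "open V" "w \<in> V" "\<forall>j\<ge>m. w j = 0"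
    and sub: "\<And>v. v \<in> V \<Longrightarrow> \<forall>j\<ge>m. v j = 0 \<Longrightarrow> v \<in> lorentz m"
  shows "tail_norm m w < w 0"
proof -
  define \<gamma> where "\<gamma> e = (\<lambda>j. if j = 0 then w 0 - e else w j)" for e :: real
  have "continuous_on UNIV (\<lambda>e. if j = 0 then w 0 - e else w j)" for j
    by (cases "j = 0") (auto intro!: continuous_intros)
  then have "continuous_on UNIV \<gamma>"
    unfolding \<gamma>_def by (rule continuous_on_coordinatewise_then_product)
  then have "open (\<gamma> -` V)" using \<open>open V\<close> by (simp add: open_vimage)
  moreover have "\<gamma> 0 = w" by (auto simp: \<gamma>_def)
  then have "0 \<in> \<gamma> -` V" using \<open>w \<in> V\<close> by simp
  ultimately obtain e where e: "e > 0" "cball 0 e \<subseteq> \<gamma> -` V"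
    using open_contains_cball by blast
  then have "\<gamma> e \<in> V" by (auto simp: subset_iff)
  then have "\<gamma> e \<in> lorentz m" using assms(1,4) by (intro sub) (auto simp: \<gamma>_def)
  moreover have "tail_norm m (\<gamma> e) = tail_norm m w"
    by (rule tail_norm_cong) (simp add: \<gamma>_def)
  ultimately show ?thesis using e(1) by (simp add: mem_lorentz \<gamma>_def)
qed

text \<open>The case \<open>m = 1\<close> is covered: the tail norm is then \<open>0\<close> and both sides are false.\<close>

lemma mem_bd_plus:
  assumes "m \<ge> 1"
  shows "w \<in> bd_plus m \<longleftrightarrow> (\<forall>j\<ge>m. w j = 0) \<and> tail_norm m w = w 0 \<and> w 0 > 0"
proof -
  have coord: "continuous_on UNIV (\<lambda>w::nat\<Rightarrow>real. w j)" for j by simp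
  have opn: "open {w. tail_norm m w < w 0}" and cl: "closed {w. tail_norm m w \<le> w 0}"
    by (auto intro!: open_Collect_less closed_Collect_le continuous_intros coord)
  have lor: "lorentz m = {w. \<forall>j\<ge>m. w j = 0} \<inter> {w. tail_norm m w \<le> w 0}"
    by (auto simp: mem_lorentz)
  have "Euclidean_space m closure_of lorentz m = lorentz m"
    unfolding closure_of_eq Euclidean_space_eq_top_of_set lor
    using closedin_closed_Int[OF cl] by blast
  moreover have "w \<in> Euclidean_space m interior_of lorentz m
      \<longleftrightarrow> (\<forall>j\<ge>m. w j = 0) \<and> tail_norm m w < w 0"
  proof
    assume "w \<in> Euclidean_space m interior_of lorentz m"
    then obtain V where "open V" "w \<in> {w. \<forall>j\<ge>m. w j = 0} \<inter> V" "{w. \<forall>j\<ge>m. w j = 0} \<inter> V \<subseteq> lorentz m"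
      unfolding interior_of_def Euclidean_space_eq_top_of_set openin_open by auto
    then show "(\<forall>j\<ge>m. w j = 0) \<and> tail_norm m w < w 0"
      using interior_point_of_lorentz[OF assms] by blast
  next
    assume "(\<forall>j\<ge>m. w j = 0) \<and> tail_norm m w < w 0"
    then show "w \<in> Euclidean_space m interior_of lorentz m"
      unfolding interior_of_def Euclidean_space_eq_top_of_set
      using openin_open_Int[OF opn, of "{w. \<forall>j\<ge>m. w j = 0}"] by (force simp: mem_lorentz)
  qed
  moreover have "w = (\<lambda>_. 0) \<longleftrightarrow> w 0 = 0" if "\<forall>j\<ge>m. w j = 0" "tail_norm m w = w 0"
    using that tail_norm_eq_0[of m w] by (auto simp: fun_eq_iff) (metis One_nat_def atLeastLessThan_iff leI less_one)
  moreover have "w 0 \<ge> 0" if "tail_norm m w = w 0"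
    using tail_norm_nonneg[of m w] that by linarith
  ultimately show ?thesis
    unfolding bd_plus_def frontier_of_def by (auto simp: mem_lorentz)
qed

lemma interior_of_Kcone:
  assumes w: "w \<in> top_of_set (block_space r m) interior_of Kcone r m"
    and "i < r" "m i \<ge> 1"
  shows "tail_norm (m i) (w i) < w i 0"
proof -
  obtain V where V: "open V" "w \<in> block_space r m \<inter> V" "block_space r m \<inter> V \<subseteq> Kcone r m"
    using w unfolding interior_of_def openin_open by auto
  define ins where "ins y = (\<lambda>k. if k = i then y else w k)" for y :: "nat \<Rightarrow> real"
  have "continuous_on UNIV (\<lambda>y. if k = i then y else w k)" for k
    by (cases "k = i") (auto intro!: continuous_intros)
  then have "continuous_on UNIV ins"
    unfolding ins_def by (rule continuous_on_coordinatewise_then_product)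
  then have "open (ins -` V)" using V(1) by (simp add: open_vimage)
  moreover have "ins (w i) = w" by (auto simp: ins_def)
  then have "w i \<in> ins -` V" using V(2) by simp
  moreover have "\<forall>j\<ge>m i. w i j = 0"
    using V(2) \<open>i < r\<close> by (simp add: block_space_def topspace_Euclidean_space)
  moreover have "v \<in> lorentz (m i)" if "v \<in> ins -` V" "\<forall>j\<ge>m i. v j = 0" for v
  proof -
    have "ins v \<in> block_space r m"
      using V(2) that(2) \<open>i < r\<close> by (auto simp: block_space_def topspace_Euclidean_space ins_def)
    then have "ins v \<in> Kcone r m" using V(3) that(1) by auto
    then have "ins v i \<in> lorentz (m i)" using \<open>i < r\<close> by (simp add: Kcone_def)
    then show ?thesis by (simp add: ins_def)
  qed
  ultimately show ?thesis
    by (intro interior_point_of_lorentz[OF \<open>m i \<ge> 1\<close>])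
qed

lemma lorentz_inner_lower_bound:
  assumes "m \<ge> 1" "tail_norm m v \<le> v 0" "tail_norm m w \<le> w 0"
  shows "v 0 * (w 0 - tail_norm m w) \<le> (\<Sum>j<m. v j * w j)"
proof -
  have "- (\<Sum>j=1..<m. v j * w j) \<le> tail_norm m v * tail_norm m w"
    using tail_norm_cauchy_schwarz[where v = v and w = w and m = m] by linarith
  also have "\<dots> \<le> v 0 * tail_norm m w"
    using assms(2) by (intro mult_right_mono) auto
  finally show ?thesis
    by (simp add: sum_lessThan_head[OF assms(1)] right_diff_distrib)
qed

lemma lorentz_inner_interior_nonpos:
  assumes "m \<ge> 1" "tail_norm m v \<le> v 0" "tail_norm m w < w 0" "(\<Sum>j<m. v j * w j) \<le> 0" "j < m"
  shows "v j = 0"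
proof -
  have "v 0 * (w 0 - tail_norm m w) \<le> 0"
    using lorentz_inner_lower_bound[OF assms(1,2) less_imp_le[OF assms(3)]] assms(4) by linarith
  then have "v 0 \<le> 0" using assms(3) by (simp add: mult_le_0_iff)
  moreover have "tail_norm m v \<ge> 0" by simp
  ultimately have "v 0 = 0" "tail_norm m v = 0" using assms(2) by linarith+
  then show ?thesis using assms(5) by (cases "j = 0") (auto simp: tail_norm_eq_0)
qed

text \<open>Tested against \<open>(\<parallel>v\<parallel>, -v)\<close> with the tail of \<open>v\<close>, which lies on the boundary of the cone, or against the axis
if the tail is zero.\<close>

lemma lorentz_self_dual:
  assumes "m \<ge> 1" and dual: "\<And>w. w \<in> lorentz m \<Longrightarrow> (\<Sum>j<m. v j * w j) \<ge> 0"
  shows "tail_norm m v \<le> v 0"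
proof (cases "tail_norm m v = 0")
  case True
  define w :: "nat \<Rightarrow> real" where "w j = (if j = 0 then 1 else 0)" for j
  have "tail_norm m w = 0" by (simp add: tail_norm_eq_0 w_def)
  then have "w \<in> lorentz m" using assms(1) by (auto simp: mem_lorentz w_def)
  from dual[OF this] show ?thesis
    using True by (simp add: sum_lessThan_head[OF assms(1)] w_def)
next
  case False
  define w where "w j = (if j = 0 then tail_norm m v else if j < m then - v j else 0)" for j
  have "tail_norm m w = tail_norm m (\<lambda>j. - v j)" by (rule tail_norm_cong) (simp add: w_def)
  then have "w \<in> lorentz m" using assms(1) by (auto simp: mem_lorentz tail_norm_minus w_def)
  from dual[OF this] have "0 \<le> v 0 * tail_norm m v - (\<Sum>j=1..<m. v j * v j)"
    by (simp add: sum_lessThan_head[OF assms(1)] w_def sum_negf)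
  then have "tail_norm m v * tail_norm m v \<le> v 0 * tail_norm m v"
    using tail_norm_power2[of m v] by (simp add: power2_eq_square)
  moreover have "tail_norm m v > 0" using False tail_norm_nonneg[of m v] by linarith
  ultimately show ?thesis by (simp add: mult_le_cancel_right)
qed

lemma C2_on_tail_norm:
  fixes G :: "'a::euclidean_space \<Rightarrow> nat \<Rightarrow> real"
  assumes G: "\<And>j. 1 \<le> j \<Longrightarrow> j < m \<Longrightarrow> C2_on U (\<lambda>x. G x j) (G' j) (G'' j)"
    and pos: "\<And>x. x \<in> U \<Longrightarrow> tail_norm m (G x) > 0"
  shows "C2_on U (\<lambda>x. tail_norm m (G x))
    (\<lambda>x. (1 / tail_norm m (G x)) *\<^sub>R (\<Sum>j=1..<m. G x j *\<^sub>R G' j x))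
    (\<lambda>x v. (1 / tail_norm m (G x)) *\<^sub>R (\<Sum>j=1..<m. G x j *\<^sub>R G'' j x v + (v \<bullet> G' j x) *\<^sub>R G' j x)
       - ((v \<bullet> (\<Sum>j=1..<m. G x j *\<^sub>R G' j x)) / tail_norm m (G x) ^ 3) *\<^sub>R (\<Sum>j=1..<m. G x j *\<^sub>R G' j x))"
proof -
  define S where "S x = (\<Sum>j=1..<m. (G x j)\<^sup>2)" for x
  have S: "S x > 0" if "x \<in> U" for x
    using pos[OF that] by (simp add: tail_norm_eq_sqrt S_def)
  have "C2_on U (\<lambda>x. (G x j)\<^sup>2) (\<lambda>x. (2 * G x j) *\<^sub>R G' j x)
      (\<lambda>x v. (2 * G x j) *\<^sub>R G'' j x v + (2 * (v \<bullet> G' j x)) *\<^sub>R G' j x)" if "j \<in> {1..<m}" for j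
    using C2_on_square[OF G, of j 2 0] that by simp
  from C2_on_sum[of "{1..<m}" U "\<lambda>j x. (G x j)\<^sup>2", OF this, folded S_def]
  have sq: "C2_on U S (\<lambda>x. 2 *\<^sub>R (\<Sum>j=1..<m. G x j *\<^sub>R G' j x))
      (\<lambda>x v. 2 *\<^sub>R (\<Sum>j=1..<m. G x j *\<^sub>R G'' j x v + (v \<bullet> G' j x) *\<^sub>R G' j x))"
    by (simp add: scaleR_sum_right scaleR_add_right)
  have d1: "(sqrt has_real_derivative inverse (sqrt s) / 2) (at s)" if "s > 0" for s
    using that by (rule DERIV_real_sqrt)
  have d2: "((\<lambda>s. inverse (sqrt s) / 2) has_real_derivative - (1 / (4 * sqrt s ^ 3))) (at s)" if "s > 0" for s
    using that by (auto intro!: derivative_eq_intros simp: field_simps power2_eq_square power3_eq_cube)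
  have d3: "isCont (\<lambda>s. - (1 / (4 * sqrt s ^ 3))) s" if "s > 0" for s
    using that by (intro continuous_intros) auto
  have e1: "(inverse s / 2) *\<^sub>R 2 *\<^sub>R X = (1 / s) *\<^sub>R X" for s and X :: 'a
    by (simp add: inverse_eq_divide)
  have e2: "Y + (- (1 / (4 * t)) * (v \<bullet> 2 *\<^sub>R X)) *\<^sub>R 2 *\<^sub>R X = Y - ((v \<bullet> X) / t) *\<^sub>R X"
    for t and v X Y :: 'a
    by simp
  from C2_on_compose[OF sq, of sqrt "\<lambda>s. inverse (sqrt s) / 2" "\<lambda>s. - (1 / (4 * sqrt s ^ 3))"] d1 d2 d3 S
  have "C2_on U (\<lambda>x. sqrt (S x)) (\<lambda>x. (inverse (sqrt (S x)) / 2) *\<^sub>R 2 *\<^sub>R (\<Sum>j=1..<m. G x j *\<^sub>R G' j x))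
    (\<lambda>x v. (inverse (sqrt (S x)) / 2) *\<^sub>R 2 *\<^sub>R (\<Sum>j=1..<m. G x j *\<^sub>R G'' j x v + (v \<bullet> G' j x) *\<^sub>R G' j x)
      + (- (1 / (4 * sqrt (S x) ^ 3)) * (v \<bullet> 2 *\<^sub>R (\<Sum>j=1..<m. G x j *\<^sub>R G' j x)))
         *\<^sub>R 2 *\<^sub>R (\<Sum>j=1..<m. G x j *\<^sub>R G' j x))"
    by blast
  moreover have "tail_norm m (G x) = sqrt (S x)" for x
    by (simp add: tail_norm_eq_sqrt S_def)
  ultimately show ?thesis
    by (simp only: e1 e2)
qed

section \<open>Reduction to constraints that vanish at the reference point\<close>

text \<open>Indices of the components of the reduced constraint: \<open>Inl i\<close> stands for \<open>h\<^sub>i\<close>, \<open>Inr (Inl i)\<close> for the gap of a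
block \<open>i \<in> I\<^sub>B\<close>, and \<open>Inr (Inr (i, j))\<close> for the entry \<open>j\<close> of a block \<open>i \<in> I\<^sub>0\<close>.\<close>

type_synonym con = "nat + nat + nat \<times> nat"

locale nsocp_point =
  fixes f :: "real^'n \<Rightarrow> real" and r :: nat and m :: "nat \<Rightarrow> nat"
    and g :: "real^'n \<Rightarrow> nat \<Rightarrow> nat \<Rightarrow> real" and p :: nat and h :: "real^'n \<Rightarrow> nat \<Rightarrow> real"
    and xs :: "real^'n"
  assumes data: "nsocp_data f r m g p h" and feas: "xs \<in> feasible r m g h"
begin

abbreviation "I0 \<equiv> I_0 r g xs"
abbreviation "IB \<equiv> I_B r m g xs"
abbreviation "T i x \<equiv> tail_norm (m i) (g x i)"
abbreviation "dg i j x \<equiv> grad (\<lambda>y. g y i j) x"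
abbreviation "ddg i j x v \<equiv> hessian (\<lambda>y. g y i j) x *v v"
abbreviation "dh i x \<equiv> grad (\<lambda>y. h y i) x"
abbreviation "ddh i x v \<equiv> hessian (\<lambda>y. h y i) x *v v"

definition gap :: "nat \<Rightarrow> real^'n \<Rightarrow> real" where
  "gap i x = g x i 0 - T i x"

definition gap' :: "nat \<Rightarrow> real^'n \<Rightarrow> real^'n" where
  "gap' i x = dg i 0 x - (1 / T i x) *\<^sub>R (\<Sum>j=1..<m i. g x i j *\<^sub>R dg i j x)"

text \<open>The subtracted bracket is the second derivative of the tail norm.\<close>

definition gap'' :: "nat \<Rightarrow> real^'n \<Rightarrow> real^'n \<Rightarrow> real^'n" where
  "gap'' i x v = ddg i 0 x v
    - ((1 / T i x) *\<^sub>R (\<Sum>j=1..<m i. g x i j *\<^sub>R ddg i j x v + (v \<bullet> dg i j x) *\<^sub>R dg i j x)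
       - ((v \<bullet> (\<Sum>j=1..<m i. g x i j *\<^sub>R dg i j x)) / T i x ^ 3) *\<^sub>R (\<Sum>j=1..<m i. g x i j *\<^sub>R dg i j x))"

definition idx :: "con set" where
  "idx = {..<p} <+> (IB <+> Sigma I0 (\<lambda>i. {..<m i}))"

definition G :: "con \<Rightarrow> real^'n \<Rightarrow> real" where
  "G = case_sum (\<lambda>i x. h x i) (case_sum gap (\<lambda>(i, j) x. g x i j))"

definition G' :: "con \<Rightarrow> real^'n \<Rightarrow> real^'n" where
  "G' = case_sum dh (case_sum gap' (\<lambda>(i, j). dg i j))"

definition G'' :: "con \<Rightarrow> real^'n \<Rightarrow> real^'n \<Rightarrow> real^'n" where
  "G'' = case_sum ddh (case_sum gap'' (\<lambda>(i, j). ddg i j))"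

lemma G_simps [simp]:
  "G (Inl i) x = h x i" "G (Inr (Inl i)) x = gap i x" "G (Inr (Inr (i, j))) x = g x i j"
  "G' (Inl i) x = dh i x" "G' (Inr (Inl i)) x = gap' i x" "G' (Inr (Inr (i, j))) x = dg i j x"
  "G'' (Inl i) x v = ddh i x v" "G'' (Inr (Inl i)) x v = gap'' i x v" "G'' (Inr (Inr (i, j))) x v = ddg i j x v"
  by (simp_all add: G_def G'_def G''_def)

definition Q :: "(con \<Rightarrow> real) set" where
  "Q = {P. (\<forall>a. a \<notin> idx \<longrightarrow> P a = 0) \<and> (\<forall>i<p. P (Inl i) = 0) \<and> (\<forall>i\<in>IB. 0 \<le> P (Inr (Inl i))) \<and>
    (\<forall>i\<in>I0. tail_norm (m i) (\<lambda>j. P (Inr (Inr (i, j)))) \<le> P (Inr (Inr (i, 0))))}"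

text \<open>The open region around \<open>xs\<close> in which the inactive blocks stay in the interior of their cones and the gaps are
smooth.\<close>

definition regular_region :: "(real^'n) set" where
  "regular_region = {x. (\<forall>i\<in>{..<r} - (I0 \<union> IB). T i x < g x i 0) \<and> (\<forall>i\<in>IB. 0 < T i x)}"

lemma m_ge_1: "i < r \<Longrightarrow> m i \<ge> 1"
  using data by (simp add: nsocp_data_def)

lemma I0_D: "i \<in> I0 \<Longrightarrow> i < r" "i \<in> I0 \<Longrightarrow> g xs i j = 0"
  by (simp_all add: I_0_def)

lemma IB_D: "i \<in> IB \<Longrightarrow> i < r" "i \<in> IB \<Longrightarrow> T i xs = g xs i 0" "i \<in> IB \<Longrightarrow> 0 < g xs i 0"
  by (auto simp: I_B_def mem_bd_plus[OF m_ge_1])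

lemma I0_IB_disjoint: "I0 \<inter> IB = {}"
  using I0_D(2) IB_D(3) by fastforce

lemma finite_index: "finite I0" "finite IB" "finite idx"
proof -
  show "finite I0" "finite IB" by (simp_all add: I_0_def I_B_def)
  then show "finite idx" by (simp add: idx_def)
qed

lemma mem_idx [simp]:
  "Inl i \<in> idx \<longleftrightarrow> i < p" "Inr (Inl i) \<in> idx \<longleftrightarrow> i \<in> IB" "Inr (Inr (i, j)) \<in> idx \<longleftrightarrow> i \<in> I0 \<and> j < m i"
  by (auto simp: idx_def)

lemma sum_idx:
  "(\<Sum>a\<in>idx. F a) = (\<Sum>i<p. F (Inl i)) + ((\<Sum>i\<in>IB. F (Inr (Inl i))) + (\<Sum>i\<in>I0. \<Sum>j<m i. F (Inr (Inr (i, j)))))"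
  unfolding idx_def using finite_index(1,2)
  by (simp add: sum.Plus sum.Sigma)

lemma sum_blocks:
  fixes F :: "nat \<Rightarrow> 'b::comm_monoid_add"
  assumes "\<And>i. i < r \<Longrightarrow> i \<notin> I0 \<Longrightarrow> i \<notin> IB \<Longrightarrow> F i = 0"
  shows "(\<Sum>i<r. F i) = (\<Sum>i\<in>IB. F i) + (\<Sum>i\<in>I0. F i)"
proof -
  have "(\<Sum>i<r. F i) = (\<Sum>i\<in>IB \<union> I0. F i)"
    using assms I0_D(1) IB_D(1) by (intro sum.mono_neutral_right) auto
  then show ?thesis
    using finite_index(1,2) I0_IB_disjoint by (simp add: sum.union_disjoint Int_commute)
qed

lemma g_block: "i < r \<Longrightarrow> j \<ge> m i \<Longrightarrow> g x i j = 0"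
  using data by (simp add: nsocp_data_def block_space_def topspace_Euclidean_space)

lemma C2_on_g: "i < r \<Longrightarrow> j < m i \<Longrightarrow> C2_on V (\<lambda>x. g x i j) (dg i j) (ddg i j)"
  by (rule C2_on_subset[OF C2_imp_C2_on subset_UNIV]) (use data in \<open>simp add: nsocp_data_def\<close>)

lemma C2_on_h: "i < p \<Longrightarrow> C2_on V (\<lambda>x. h x i) (dh i) (ddh i)"
  by (rule C2_on_subset[OF C2_imp_C2_on subset_UNIV]) (use data in \<open>simp add: nsocp_data_def\<close>)

lemma continuous_g: "i < r \<Longrightarrow> continuous_on V (\<lambda>x. g x i j)"
proof (cases "j < m i")
  case True
  then show "i < r \<Longrightarrow> continuous_on V (\<lambda>x. g x i j)"
    using C2_onD(5)[OF C2_on_g UNIV_I] by (simp add: continuous_at_imp_continuous_on)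
qed (simp add: g_block)

lemma C2_on_gap:
  assumes "i \<in> IB"
  shows "C2_on regular_region (gap i) (gap' i) (gap'' i)"
proof -
  have i: "i < r" "m i \<ge> 1" using IB_D(1)[OF assms] m_ge_1 by auto
  have T: "C2_on regular_region (\<lambda>x. T i x)
    (\<lambda>x. (1 / T i x) *\<^sub>R (\<Sum>j=1..<m i. g x i j *\<^sub>R dg i j x))
    (\<lambda>x v. (1 / T i x) *\<^sub>R (\<Sum>j=1..<m i. g x i j *\<^sub>R ddg i j x v + (v \<bullet> dg i j x) *\<^sub>R dg i j x)
       - ((v \<bullet> (\<Sum>j=1..<m i. g x i j *\<^sub>R dg i j x)) / T i x ^ 3) *\<^sub>R (\<Sum>j=1..<m i. g x i j *\<^sub>R dg i j x))"
    by (rule C2_on_tail_norm) (use C2_on_g i assms in \<open>auto simp: regular_region_def\<close>)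
  show ?thesis
    unfolding gap_def gap'_def gap''_def
    using C2_on_diff[OF C2_on_g[of i 0] T] i by simp
qed

lemma C2_on_G: "a \<in> idx \<Longrightarrow> C2_on regular_region (G a) (G' a) (G'' a)"
proof -
  assume a: "a \<in> idx"
  have *: "C2_on regular_region (\<lambda>x. G a x) (\<lambda>x. G' a x) (\<lambda>x v. G'' a x v)"
  proof (cases a)
    case (Inl i)
    then show ?thesis using C2_on_h a by simp
  next
    case (Inr b)
    show ?thesis
    proof (cases b)
      case (Inl i)
      then show ?thesis using C2_on_gap a Inr by simp
    next
      case (Inr ij)
      then show ?thesis using C2_on_g I0_D(1) a \<open>a = Inr b\<close> by (cases ij) simp
    qed
  qed
  then show ?thesis by simp
qed

lemma open_regular_region: "open regular_region"
proof -
  have eq: "regular_region = (\<Inter>i\<in>{..<r} - (I0 \<union> IB). {x. T i x < g x i 0}) \<inter> (\<Inter>i\<in>IB. {x. 0 < T i x})"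
    by (auto simp: regular_region_def)
  have "open {x. T i x < g x i 0}" "open {x. 0 < T i x}" if "i < r" for i
    by (intro open_Collect_less continuous_intros continuous_g that)+
  then show ?thesis
    unfolding eq using finite_index(2) IB_D(1) by (intro open_Int open_INT) auto
qed

lemma xs_in_regular_region: "xs \<in> regular_region"
proof -
  have "T i xs < g xs i 0" if "i < r" "i \<notin> I0" "i \<notin> IB" for i
  proof -
    have lor: "g xs i \<in> lorentz (m i)" using feas that(1) by (simp add: feasible_def Kcone_def)
    moreover have "T i xs \<noteq> g xs i 0"
    proof
      assume eq: "T i xs = g xs i 0"
      then have "g xs i 0 = 0"
        using that(1,3) lor mem_bd_plus[OF m_ge_1[OF that(1)], of "g xs i"] tail_norm_nonneg[of "m i" "g xs i"]
        by (auto simp: I_B_def mem_lorentz)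
      then have "g xs i j = 0" for j
        using eq lor by (cases "j = 0"; cases "j < m i") (auto simp: tail_norm_eq_0 mem_lorentz)
      then have "g xs i = (\<lambda>_. 0)" by (rule ext)
      then show False using that(1,2) by (simp add: I_0_def)
    qed
    ultimately show ?thesis by (simp add: mem_lorentz)
  qed
  then show ?thesis using IB_D(2,3) by (auto simp: regular_region_def)
qed

lemma G_xs: "a \<in> idx \<Longrightarrow> G a xs = 0"
proof -
  assume "a \<in> idx"
  moreover have "h xs i = 0" for i using feas by (simp add: feasible_def)
  ultimately show "G a xs = 0"
    unfolding idx_def using I0_D(2) IB_D(2) by (auto simp: gap_def)
qed

lemma feasible_if_reduced:
  assumes x: "x \<in> regular_region" and red: "(\<lambda>a. if a \<in> idx then G a x else 0) \<in> Q"
  shows "x \<in> feasible r m g h"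
proof -
  have "g x \<in> block_space r m" "h x \<in> topspace (Euclidean_space p)"
    using data by (auto simp: nsocp_data_def)
  moreover have "h x i = 0" if "i < p" for i using red that by (simp add: Q_def)
  moreover have "g x i \<in> lorentz (m i)" if "i < r" for i
  proof -
    have "T i x \<le> g x i 0"
    proof (cases "i \<in> I0")
      case True
      have "tail_norm (m i) (\<lambda>j. if j < m i then g x i j else 0) = T i x"
        by (rule tail_norm_cong) simp
      moreover have "0 < m i" using m_ge_1[OF that] by simp
      ultimately show ?thesis using red True by (force simp: Q_def cong: if_cong)
    next
      case False
      then show ?thesis
        using red x that by (cases "i \<in> IB") (auto simp: Q_def gap_def regular_region_def intro!: less_imp_le)
    qed
    then show ?thesis using g_block[OF that] by (simp add: mem_lorentz)
  qed
  ultimately show ?thesis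
    by (auto simp: feasible_def Kcone_def topspace_Euclidean_space fun_eq_iff) (metis not_less)
qed

lemma closed_Q: "closed Q"
proof -
  have coord: "continuous_on UNIV (\<lambda>P::con \<Rightarrow> real. P a)" for a by simp
  show ?thesis
    unfolding Q_def Collect_conj_eq Collect_all_eq Collect_ball_eq Ball_def
    by (intro closed_Int closed_INT closed_Collect_all closed_Collect_imp closed_Collect_le closed_Collect_eq
        continuous_intros coord allI ballI open_Collect_const)
qed

lemma zero_in_Q: "(\<lambda>_. 0) \<in> Q"
  by (simp add: Q_def tail_norm_eq_0)

lemma Q_cone:
  assumes "P \<in> Q" "R \<in> Q" "t > 0"
  shows "(\<lambda>a. P a + t * R a) \<in> Q"
proof -
  have "tail_norm (m i) (\<lambda>j. P (Inr (Inr (i, j))) + t * R (Inr (Inr (i, j))))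
      \<le> P (Inr (Inr (i, 0))) + t * R (Inr (Inr (i, 0)))" if "i \<in> I0" for i
  proof -
    have "tail_norm (m i) (\<lambda>j. P (Inr (Inr (i, j)))) + t * tail_norm (m i) (\<lambda>j. R (Inr (Inr (i, j))))
        \<le> P (Inr (Inr (i, 0))) + t * R (Inr (Inr (i, 0)))"
      using assms that by (intro add_mono mult_left_mono) (auto simp: Q_def)
    then show ?thesis
      using tail_norm_add_scale[of t "m i" "\<lambda>j. P (Inr (Inr (i, j)))" "\<lambda>j. R (Inr (Inr (i, j)))"] assms(3)
      by linarith
  qed
  then show ?thesis using assms by (auto simp: Q_def)
qed

text \<open>Testing with one coordinate vector gives the sign of the multiplier of a gap, and testing with one block gives
membership in the cone by self-duality.\<close>

lemma polar_Q:
  assumes polar: "\<And>R. R \<in> Q \<Longrightarrow> (\<Sum>a\<in>idx. \<nu> a * R a) \<le> 0"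
  shows "i \<in> IB \<Longrightarrow> \<nu> (Inr (Inl i)) \<le> 0"
    and "i \<in> I0 \<Longrightarrow> tail_norm (m i) (\<lambda>j. - \<nu> (Inr (Inr (i, j)))) \<le> - \<nu> (Inr (Inr (i, 0)))"
proof -
  assume i: "i \<in> IB"
  define R :: "con \<Rightarrow> real" where "R a = (if a = Inr (Inl i) then 1 else 0)" for a
  have "R \<in> Q" using i by (auto simp: Q_def R_def tail_norm_eq_0)
  from polar[OF this] show "\<nu> (Inr (Inl i)) \<le> 0"
    using i finite_index(3) by (simp add: R_def if_distrib[of "\<lambda>t. _ * t"] cong: if_cong)
next
  assume i: "i \<in> I0"
  then have m1: "m i \<ge> 1" using I0_D(1) m_ge_1 by blast
  show "tail_norm (m i) (\<lambda>j. - \<nu> (Inr (Inr (i, j)))) \<le> - \<nu> (Inr (Inr (i, 0)))"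
  proof (rule lorentz_self_dual[OF m1])
    fix w assume w: "w \<in> lorentz (m i)"
    define R :: "con \<Rightarrow> real" where
      "R = case_sum (\<lambda>_. 0) (case_sum (\<lambda>_. 0) (\<lambda>(k, j). if k = i then w j else 0))"
    have "a \<notin> idx \<Longrightarrow> R a = 0" for a
      using i w by (auto simp: R_def mem_lorentz split: sum.split)
    then have "R \<in> Q" using w by (auto simp: Q_def R_def mem_lorentz tail_norm_eq_0)
    from polar[OF this] have "(\<Sum>a\<in>idx. \<nu> a * R a) \<le> 0" .
    moreover have "R (Inl k) = 0" "R (Inr (Inl k)) = 0" for k by (simp_all add: R_def)
    moreover have "(\<Sum>j<m k. \<nu> (Inr (Inr (k, j))) * R (Inr (Inr (k, j))))
        = (if k = i then \<Sum>j<m i. \<nu> (Inr (Inr (i, j))) * w j else 0)" for k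
      by (simp add: R_def)
    ultimately have "(\<Sum>k\<in>I0. if k = i then \<Sum>j<m i. \<nu> (Inr (Inr (i, j))) * w j else 0) \<le> 0"
      by (simp add: sum_idx)
    then show "0 \<le> (\<Sum>j<m i. - \<nu> (Inr (Inr (i, j))) * w j)"
      using i finite_index(1) by (simp add: sum_negf)
  qed
qed

section \<open>Tangent directions, the critical subspace and Robinson's condition\<close>

text \<open>The pairing with the inner normal \<open>(1, -tail/norm)\<close> of the cone at the boundary point \<open>g xs i\<close>.\<close>

definition bd_normal :: "nat \<Rightarrow> (nat \<Rightarrow> real) \<Rightarrow> real" where
  "bd_normal i w = w 0 - (1 / T i xs) * (\<Sum>j=1..<m i. g xs i j * w j)"

lemma bd_normal_lower_bound:
  assumes "i \<in> IB"
  shows "w 0 - tail_norm (m i) w \<le> bd_normal i w"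
proof -
  have T: "T i xs > 0" using IB_D(2,3)[OF assms] by simp
  have "(\<Sum>j=1..<m i. g xs i j * w j) \<le> T i xs * tail_norm (m i) w"
    using tail_norm_cauchy_schwarz[where v = "g xs i" and w = w and m = "m i"] by linarith
  then have "(1 / T i xs) * (\<Sum>j=1..<m i. g xs i j * w j) \<le> tail_norm (m i) w"
    using T by (simp add: field_simps)
  then show ?thesis by (simp add: bd_normal_def)
qed

lemma bd_normal_add_scale: "bd_normal i (\<lambda>j. v j + t * w j) = bd_normal i v + t * bd_normal i w"
  by (simp add: bd_normal_def algebra_simps sum.distrib sum_distrib_left)

lemma bd_normal_self:
  assumes "i \<in> IB"
  shows "bd_normal i (g xs i) = 0"
proof -
  have "T i xs \<noteq> 0" using IB_D(2,3)[OF assms] by simp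
  moreover have "bd_normal i (g xs i) = g xs i 0 - (1 / T i xs) * (T i xs)\<^sup>2"
    unfolding bd_normal_def tail_norm_power2 by (rule refl)
  ultimately have "bd_normal i (g xs i) = g xs i 0 - T i xs" by (simp add: power2_eq_square)
  then show ?thesis using IB_D(2)[OF assms] by simp
qed

lemma bd_normal_cong: "(\<And>j. j < m i \<Longrightarrow> v j = w j) \<Longrightarrow> i \<in> IB \<Longrightarrow> bd_normal i v = bd_normal i w"
  using m_ge_1[OF IB_D(1), of i] by (simp add: bd_normal_def)

lemma gap'_inner: "gap' i xs \<bullet> d = bd_normal i (\<lambda>j. dg i j xs \<bullet> d)"
  by (simp add: gap'_def bd_normal_def inner_diff_left inner_sum_left)

lemma JTmult_Gam_tilde:
  assumes "i \<in> IB" "x \<in> regular_region"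
  shows "JTmult (m i) (\<lambda>y. g y i) x (Gam (tilde (m i) (g x i))) = T i x *\<^sub>R gap' i x"
proof -
  have "T i x > 0" using assms by (simp add: regular_region_def)
  moreover have "m i \<ge> 1" using assms m_ge_1 IB_D(1) by blast
  ultimately show ?thesis
    by (simp add: JTmult_def sum_lessThan_head gap'_def Gam_def tilde_def scaleR_diff_right sum_negf)
qed

text \<open>Each vector \<open>Dg\<^sub>i\<^sup>T \<Gamma> g~\<^sub>i\<close> is a nonzero multiple of the gradient of \<open>gap i\<close>, so the WCR family spans the same
space as the gradients of the reduced constraint. This holds also at points off the boundary of the cone, because the
definition uses \<open>g~\<^sub>i\<close> in place of \<open>g\<^sub>i\<close>.\<close>

lemma dim_wcr_family:
  assumes x: "x \<in> regular_region"
  shows "dim ((\<lambda>a. G' a x) ` idx) = dim (wcr_family r m g p h xs x)"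
proof -
  let ?S = "(\<lambda>a. G' a x) ` idx" and ?F = "wcr_family r m g p h xs x"
  have T: "T i x \<noteq> 0" if "i \<in> IB" for i using that x by (auto simp: regular_region_def)
  have "?S \<subseteq> span ?F"
  proof (rule image_subsetI)
    fix a assume "a \<in> idx"
    then consider i where "a = Inl i" "i < p" | i where "a = Inr (Inl i)" "i \<in> IB"
      | i j where "a = Inr (Inr (i, j))" "i \<in> I0" "j < m i"
      by (auto simp: idx_def)
    then show "G' a x \<in> span ?F"
    proof cases
      case 1
      then show ?thesis by (auto simp: wcr_family_def intro!: span_base)
    next
      case 2
      have "JTmult (m i) (\<lambda>y. g y i) x (Gam (tilde (m i) (g x i))) \<in> span ?F"
        using 2 by (intro span_base) (auto simp: wcr_family_def)
      then have "(1 / T i x) *\<^sub>R T i x *\<^sub>R gap' i x \<in> span ?F"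
        unfolding JTmult_Gam_tilde[OF 2(2) x] by (rule span_scale)
      then show ?thesis using 2 T by simp
    next
      case 3
      then show ?thesis by (auto simp: wcr_family_def intro!: span_base)
    qed
  qed
  moreover have "?F \<subseteq> span ?S"
  proof -
    have base: "G' a x \<in> span ?S" if "a \<in> idx" for a using that by (auto intro: span_base)
    show ?thesis
      unfolding wcr_family_def
      using base[of "Inl _"] base[of "Inr (Inl _)"] base[of "Inr (Inr (_, _))"]
      by (auto simp: JTmult_Gam_tilde[OF _ x] intro!: span_scale)
  qed
  ultimately have "span ?S = span ?F" unfolding span_eq by blast
  then show ?thesis by (rule span_eq_dim)
qed

text \<open>The cone lies in the half-space of its inner normal at a boundary point, and at the origin it is its own tangent
cone; both are closed conditions on the difference quotients.\<close>

lemma critical_cone_D: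
  assumes d: "d \<in> critical_cone f r m g p h xs"
  shows "i < p \<Longrightarrow> dh i xs \<bullet> d = 0"
    and "i \<in> IB \<Longrightarrow> gap' i xs \<bullet> d \<ge> 0"
    and "i \<in> I0 \<Longrightarrow> tail_norm (m i) (\<lambda>j. dg i j xs \<bullet> d) \<le> dg i 0 xs \<bullet> d"
proof -
  have "Jmult p h xs d i = 0" for i using d by (simp add: critical_cone_def)
  then show "i < p \<Longrightarrow> dh i xs \<bullet> d = 0" by (metis Jmult_def)
  have "block_Jmult r m g xs d \<in> tangent_cone (Kcone r m) (g xs)"
    using d by (simp add: critical_cone_def)
  then have "\<exists>t u. (\<forall>k::nat. t k > (0::real)) \<and> t \<longlonglongrightarrow> 0 \<and> u \<longlonglongrightarrow> block_Jmult r m g xs d \<and>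
      (\<forall>k. (\<lambda>i j. g xs i j + t k * u k i j) \<in> Kcone r m)"
    unfolding tangent_cone_def by (rule CollectD)
  then obtain t u where tu: "(\<forall>k::nat. t k > (0::real)) \<and> t \<longlonglongrightarrow> 0 \<and> u \<longlonglongrightarrow> block_Jmult r m g xs d \<and>
      (\<forall>k. (\<lambda>i j. g xs i j + t k * u k i j) \<in> Kcone r m)"
    by (elim exE)
  have t: "t k > 0" and u: "u \<longlonglongrightarrow> block_Jmult r m g xs d"
    and K: "(\<lambda>i j. g xs i j + t k * u k i j) \<in> Kcone r m" for k
    using tu by simp_all
  have u_lim: "(\<lambda>k. u k i j) \<longlonglongrightarrow> block_Jmult r m g xs d i j" for i j
    by (rule tendsto_function_coordinate[OF tendsto_function_coordinate[OF u]])
  have lor: "tail_norm (m i) (\<lambda>j. g xs i j + t k * u k i j) \<le> g xs i 0 + t k * u k i 0" if "i < r" for i k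
    using K[of k] that by (simp add: Kcone_def mem_lorentz)
  have J: "block_Jmult r m g xs d i j = dg i j xs \<bullet> d" if "i < r" "j < m i" for i j
    using that by (simp add: block_Jmult_def Jmult_def)
  show "gap' i xs \<bullet> d \<ge> 0" if i: "i \<in> IB"
  proof -
    have "bd_normal i (u k i) \<ge> 0" for k
    proof -
      have "0 \<le> bd_normal i (\<lambda>j. g xs i j + t k * u k i j)"
        using bd_normal_lower_bound[OF i, of "\<lambda>j. g xs i j + t k * u k i j"] lor[OF IB_D(1)[OF i], of k] by linarith
      then show ?thesis
        using t[of k] by (simp add: bd_normal_add_scale bd_normal_self[OF i] zero_le_mult_iff)
    qed
    moreover have "(\<lambda>k. bd_normal i (u k i)) \<longlonglongrightarrow> bd_normal i (block_Jmult r m g xs d i)"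
      unfolding bd_normal_def by (intro tendsto_intros u_lim)
    ultimately have "0 \<le> bd_normal i (block_Jmult r m g xs d i)"
      by (intro LIMSEQ_le_const) auto
    also have "\<dots> = gap' i xs \<bullet> d"
      unfolding gap'_inner using i J[OF IB_D(1)[OF i]] by (intro bd_normal_cong) auto
    finally show ?thesis .
  qed
  show "tail_norm (m i) (\<lambda>j. dg i j xs \<bullet> d) \<le> dg i 0 xs \<bullet> d" if i: "i \<in> I0"
  proof -
    have "tail_norm (m i) (u k i) \<le> u k i 0" for k
      using lor[OF I0_D(1)[OF i], of k] t[of k] I0_D(2)[OF i] by (simp add: tail_norm_scale)
    then have "tail_norm (m i) (block_Jmult r m g xs d i) \<le> block_Jmult r m g xs d i 0"
      by (intro LIMSEQ_le[OF tendsto_tail_norm[OF u_lim] u_lim]) auto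
    moreover have "tail_norm (m i) (block_Jmult r m g xs d i) = tail_norm (m i) (\<lambda>j. dg i j xs \<bullet> d)"
      using J[OF I0_D(1)[OF i]] by (intro tail_norm_cong)
    ultimately show ?thesis using J[OF I0_D(1)[OF i], of 0] m_ge_1[OF I0_D(1)[OF i]] by simp
  qed
qed

text \<open>The reduced inequalities hold for \<open>d\<close> and for \<open>-d\<close>, and the second-order cone contains no line.\<close>

lemma critical_subspace_D:
  assumes d: "d \<in> critical_subspace f r m g p h xs" and a: "a \<in> idx"
  shows "G' a xs \<bullet> d = 0"
proof -
  have c: "d \<in> critical_cone f r m g p h xs" "- d \<in> critical_cone f r m g p h xs"
    using d by (auto simp: critical_subspace_def)
  consider i where "a = Inl i" "i < p" | i where "a = Inr (Inl i)" "i \<in> IB"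
    | i j where "a = Inr (Inr (i, j))" "i \<in> I0" "j < m i"
    using a by (auto simp: idx_def)
  then show ?thesis
  proof cases
    case 1
    then show ?thesis using critical_cone_D(1)[OF c(1)] by simp
  next
    case 2
    then show ?thesis using critical_cone_D(2)[OF c(1), of i] critical_cone_D(2)[OF c(2), of i] by simp
  next
    case 3
    define w where "w = (\<lambda>j. dg i j xs \<bullet> d)"
    have w: "tail_norm (m i) w \<le> w 0" "tail_norm (m i) w \<le> - w 0"
      using critical_cone_D(3)[OF c(1) 3(2)] critical_cone_D(3)[OF c(2) 3(2)]
      by (simp_all add: w_def tail_norm_minus)
    moreover have "tail_norm (m i) w \<ge> 0" by simp
    ultimately have "w 0 = 0" "tail_norm (m i) w = 0" by linarith+
    then have "w j = 0" using 3(3) by (cases "j = 0") (auto simp: tail_norm_eq_0)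
    then show ?thesis using 3(1) by (simp add: w_def)
  qed
qed

text \<open>Since \<open>g xs i\<close> is annihilated by the normal, respectively equal to zero, an interior point
\<open>g(xs) + Dg(xs) d\<close> yields strict inequalities for \<open>Dg(xs) d\<close> alone.\<close>

lemma robinson_direction:
  assumes "robinson_cq r m g p h xs"
  shows "\<exists>d. (\<forall>i<p. dh i xs \<bullet> d = 0) \<and> (\<forall>i\<in>IB. gap' i xs \<bullet> d > 0) \<and>
    (\<forall>i\<in>I0. tail_norm (m i) (\<lambda>j. dg i j xs \<bullet> d) < dg i 0 xs \<bullet> d)"
proof -
  obtain d where
    d: "(\<lambda>i j. g xs i j + block_Jmult r m g xs d i j) \<in> top_of_set (block_space r m) interior_of Kcone r m"
    and dh: "Jmult p h xs d = (\<lambda>_. 0)"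
    using assms unfolding robinson_cq_def by blast
  have J: "block_Jmult r m g xs d i j = dg i j xs \<bullet> d" if "i < r" "j < m i" for i j
    using that by (simp add: block_Jmult_def Jmult_def)
  have int: "tail_norm (m i) (\<lambda>j. g xs i j + dg i j xs \<bullet> d) < g xs i 0 + dg i 0 xs \<bullet> d" if "i < r" for i
  proof -
    have "tail_norm (m i) (\<lambda>j. g xs i j + block_Jmult r m g xs d i j)
        = tail_norm (m i) (\<lambda>j. g xs i j + dg i j xs \<bullet> d)"
      using J[OF that] by (intro tail_norm_cong) simp
    then show ?thesis
      using interior_of_Kcone[OF d that m_ge_1[OF that]] J[OF that, of 0] m_ge_1[OF that] by simp
  qed
  show ?thesis
  proof (intro exI[of _ d] conjI allI ballI impI)
    show "dh i xs \<bullet> d = 0" if "i < p" for i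
      using fun_cong[OF dh, of i] that by (simp add: Jmult_def)
    show "gap' i xs \<bullet> d > 0" if i: "i \<in> IB" for i
    proof -
      have "0 < bd_normal i (\<lambda>j. g xs i j + dg i j xs \<bullet> d)"
        using bd_normal_lower_bound[OF i, of "\<lambda>j. g xs i j + dg i j xs \<bullet> d"] int[OF IB_D(1)[OF i]] by linarith
      then show ?thesis
        using bd_normal_add_scale[of i "g xs i" 1] by (simp add: gap'_inner bd_normal_self[OF i])
    qed
    show "tail_norm (m i) (\<lambda>j. dg i j xs \<bullet> d) < dg i 0 xs \<bullet> d" if i: "i \<in> I0" for i
      using int[OF I0_D(1)[OF i]] I0_D(2)[OF i] by simp
  qed
qed

text \<open>Paired with the direction \<open>d\<close> of Robinson's condition, every gap and every block at the origin contributes a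
term of the same sign, so all of these terms vanish. Strictness then makes the multipliers of gaps and
blocks zero, and the linear independence of the gradients of \<open>h\<close> takes care of the others.\<close>

lemma robinson_multiplier_zero:
  assumes rob: "robinson_cq r m g p h xs"
    and polar: "\<forall>R\<in>Q. (\<Sum>a\<in>idx. \<nu> a * R a) \<le> 0"
    and eq: "(\<Sum>a\<in>idx. \<nu> a *\<^sub>R G' a xs) = 0"
  shows "\<forall>a\<in>idx. \<nu> a = 0"
proof -
  obtain d where d: "\<And>i. i < p \<Longrightarrow> dh i xs \<bullet> d = 0" "\<And>i. i \<in> IB \<Longrightarrow> gap' i xs \<bullet> d > 0"
    "\<And>i. i \<in> I0 \<Longrightarrow> tail_norm (m i) (\<lambda>j. dg i j xs \<bullet> d) < dg i 0 xs \<bullet> d"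
    using robinson_direction[OF rob] by blast
  have pol: "i \<in> IB \<Longrightarrow> \<nu> (Inr (Inl i)) \<le> 0"
    "i \<in> I0 \<Longrightarrow> tail_norm (m i) (\<lambda>j. - \<nu> (Inr (Inr (i, j)))) \<le> - \<nu> (Inr (Inr (i, 0)))" for i
    using polar_Q[of \<nu> i] polar by blast+
  have m1: "m i \<ge> 1" if "i \<in> I0" for i using m_ge_1 I0_D(1) that by blast
  define B where "B i = - \<nu> (Inr (Inl i)) * (gap' i xs \<bullet> d)" for i
  define Z where "Z i = (\<Sum>j<m i. - \<nu> (Inr (Inr (i, j))) * (dg i j xs \<bullet> d))" for i
  have B0: "B i \<ge> 0" if "i \<in> IB" for i
    unfolding B_def using pol(1)[OF that] d(2)[OF that] by (intro mult_nonneg_nonneg) auto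
  have Z0: "Z i \<ge> 0" if "i \<in> I0" for i
  proof -
    have "0 \<le> - \<nu> (Inr (Inr (i, 0)))"
      using pol(2)[OF that] tail_norm_nonneg[of "m i" "\<lambda>j. - \<nu> (Inr (Inr (i, j)))"] by linarith
    then have "0 \<le> - \<nu> (Inr (Inr (i, 0))) * (dg i 0 xs \<bullet> d - tail_norm (m i) (\<lambda>j. dg i j xs \<bullet> d))"
      using d(3)[OF that] by (intro mult_nonneg_nonneg) auto
    also have "\<dots> \<le> Z i"
      unfolding Z_def
      using lorentz_inner_lower_bound[OF m1[OF that] pol(2)[OF that], of "\<lambda>j. dg i j xs \<bullet> d"] d(3)[OF that]
      by (simp add: less_imp_le)
    finally show ?thesis .
  qed
  have "0 = (\<Sum>a\<in>idx. \<nu> a *\<^sub>R G' a xs) \<bullet> d" using eq by simp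
  also have "\<dots> = - ((\<Sum>i\<in>IB. B i) + (\<Sum>i\<in>I0. Z i))"
    using d(1) by (simp add: sum_idx inner_add_left inner_sum_left B_def Z_def sum_negf)
  finally have "(\<Sum>i\<in>IB. B i) + (\<Sum>i\<in>I0. Z i) = 0" by simp
  moreover have "(\<Sum>i\<in>IB. B i) \<ge> 0" "(\<Sum>i\<in>I0. Z i) \<ge> 0"
    using B0 Z0 by (auto intro: sum_nonneg)
  ultimately have "(\<Sum>i\<in>IB. B i) = 0" "(\<Sum>i\<in>I0. Z i) = 0" by linarith+
  then have BZ: "\<And>i. i \<in> IB \<Longrightarrow> B i = 0" "\<And>i. i \<in> I0 \<Longrightarrow> Z i = 0"
    using B0 Z0 finite_index(1,2) by (auto simp: sum_nonneg_eq_0_iff)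
  have nuB: "\<nu> (Inr (Inl i)) = 0" if "i \<in> IB" for i
    using BZ(1)[OF that] d(2)[OF that] by (simp add: B_def)
  have nuZ: "\<nu> (Inr (Inr (i, j))) = 0" if "i \<in> I0" "j < m i" for i j
    using lorentz_inner_interior_nonpos[OF m1[OF that(1)] pol(2)[OF that(1)] d(3)[OF that(1)] _ that(2)]
      BZ(2)[OF that(1)] by (simp add: Z_def)
  have nuE: "\<nu> (Inl i) = 0" if "i < p" for i
  proof -
    define v where "v = (\<lambda>i. dh i xs)"
    have dim: "dim (v ` {..<p}) = p" using rob by (simp add: robinson_cq_def v_def)
    moreover have "card (v ` {..<p}) \<le> p" using card_image_le[of "{..<p}" v] by simp
    moreover have "dim (v ` {..<p}) \<le> card (v ` {..<p})" by (rule dim_le_card') simp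
    ultimately have card: "card (v ` {..<p}) = p" by simp
    then have inj: "inj_on v {..<p}" by (intro eq_card_imp_inj_on) auto
    have indep: "independent (v ` {..<p})"
      using card dim by (intro card_le_dim_spanning[of _ "v ` {..<p}"]) (auto intro: span_base)
    \<comment> \<open>Independence is a statement on the set of gradients; injectivity carries it over to the indexed family.\<close>
    define w where "w = the_inv_into {..<p} v"
    have w: "w (v k) = k" if "k < p" for k
      using the_inv_into_f_f[OF inj] that by (simp add: w_def)
    have "(\<Sum>i<p. \<nu> (Inl i) *\<^sub>R v i) = 0"
      using eq nuB nuZ by (simp add: sum_idx v_def)
    then have "(\<Sum>y\<in>v ` {..<p}. \<nu> (Inl (w y)) *\<^sub>R y) = 0"
      using w by (simp add: sum.reindex[OF inj])
    then have "\<nu> (Inl (w (v i))) = 0"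
      using independentD[OF indep finite_imageI[OF finite_lessThan] subset_refl, of "\<lambda>y. \<nu> (Inl (w y))" "v i"] that
      by simp
    then show ?thesis using w[OF that] by simp
  qed
  show ?thesis
    unfolding idx_def using nuE nuB nuZ by auto
qed

section \<open>Multipliers of the original program\<close>

text \<open>The reduced Lagrangian adds \<open>\<nu> G\<close> whereas the original one subtracts \<open>\<langle>g, \<omega>\<rangle>\<close>, whence the signs. For \<open>i \<in> I\<^sub>B\<close>
the block is the multiple \<open>-\<nu>\<^sub>i\<close> of the inner normal \<open>(1, -tail/norm)\<close>.\<close>

definition omega :: "(con \<Rightarrow> real) \<Rightarrow> nat \<Rightarrow> nat \<Rightarrow> real" where
  "omega \<nu> i j =
    (if i \<in> I0 \<and> j < m i then - \<nu> (Inr (Inr (i, j)))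
     else if i \<in> IB \<and> j < m i then - \<nu> (Inr (Inl i)) * (if j = 0 then 1 else - (g xs i j / T i xs))
     else 0)"

definition mu :: "(con \<Rightarrow> real) \<Rightarrow> nat \<Rightarrow> real" where
  "mu \<nu> i = (if i < p then \<nu> (Inl i) else 0)"

lemma omega_I0: "i \<in> I0 \<Longrightarrow> j < m i \<Longrightarrow> omega \<nu> i j = - \<nu> (Inr (Inr (i, j)))"
  by (simp add: omega_def)

lemma omega_IB:
  assumes "i \<in> IB"
  shows "omega \<nu> i 0 = - \<nu> (Inr (Inl i))"
    and "1 \<le> j \<Longrightarrow> j < m i \<Longrightarrow> omega \<nu> i j = \<nu> (Inr (Inl i)) * (g xs i j / T i xs)"
proof -
  have "i \<notin> I0" using assms I0_IB_disjoint by blast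
  moreover have "0 < m i" using m_ge_1[OF IB_D(1)[OF assms]] by simp
  ultimately show "omega \<nu> i 0 = - \<nu> (Inr (Inl i))"
    and "1 \<le> j \<Longrightarrow> j < m i \<Longrightarrow> omega \<nu> i j = \<nu> (Inr (Inl i)) * (g xs i j / T i xs)"
    using assms by (simp_all add: omega_def)
qed

text \<open>Stated for arbitrary \<open>F\<close> because it is applied to the gradients, to the second derivatives and to the
values of the entries of \<open>g\<close>.\<close>

lemma sum_omega:
  fixes F :: "nat \<Rightarrow> nat \<Rightarrow> 'b::real_vector"
  shows "(\<Sum>i<r. \<Sum>j<m i. omega \<nu> i j *\<^sub>R F i j)
    = - ((\<Sum>i\<in>IB. \<nu> (Inr (Inl i)) *\<^sub>R (F i 0 - (1 / T i xs) *\<^sub>R (\<Sum>j=1..<m i. g xs i j *\<^sub>R F i j)))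
       + (\<Sum>i\<in>I0. \<Sum>j<m i. \<nu> (Inr (Inr (i, j))) *\<^sub>R F i j))"
proof -
  have "(\<Sum>i<r. \<Sum>j<m i. omega \<nu> i j *\<^sub>R F i j)
    = (\<Sum>i\<in>IB. \<Sum>j<m i. omega \<nu> i j *\<^sub>R F i j) + (\<Sum>i\<in>I0. \<Sum>j<m i. omega \<nu> i j *\<^sub>R F i j)"
    by (rule sum_blocks) (simp add: omega_def)
  also have "(\<Sum>i\<in>I0. \<Sum>j<m i. omega \<nu> i j *\<^sub>R F i j)
      = - (\<Sum>i\<in>I0. \<Sum>j<m i. \<nu> (Inr (Inr (i, j))) *\<^sub>R F i j)"
    by (simp add: omega_I0 sum_negf)
  also have "(\<Sum>i\<in>IB. \<Sum>j<m i. omega \<nu> i j *\<^sub>R F i j)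
      = (\<Sum>i\<in>IB. - (\<nu> (Inr (Inl i)) *\<^sub>R (F i 0 - (1 / T i xs) *\<^sub>R (\<Sum>j=1..<m i. g xs i j *\<^sub>R F i j))))"
  proof (rule sum.cong[OF refl])
    fix i assume i: "i \<in> IB"
    have "(\<Sum>j<m i. omega \<nu> i j *\<^sub>R F i j)
        = omega \<nu> i 0 *\<^sub>R F i 0 + (\<Sum>j=1..<m i. omega \<nu> i j *\<^sub>R F i j)"
      using m_ge_1[OF IB_D(1)[OF i]] by (rule sum_lessThan_head)
    also have "(\<Sum>j=1..<m i. omega \<nu> i j *\<^sub>R F i j)
        = (\<Sum>j=1..<m i. \<nu> (Inr (Inl i)) *\<^sub>R (1 / T i xs) *\<^sub>R g xs i j *\<^sub>R F i j)"
      by (rule sum.cong) (simp_all add: omega_IB(2)[OF i])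
    finally show "(\<Sum>j<m i. omega \<nu> i j *\<^sub>R F i j)
        = - (\<nu> (Inr (Inl i)) *\<^sub>R (F i 0 - (1 / T i xs) *\<^sub>R (\<Sum>j=1..<m i. g xs i j *\<^sub>R F i j)))"
      by (simp add: omega_IB(1)[OF i] scaleR_diff_right scaleR_sum_right)
  qed
  finally show ?thesis by (simp add: sum_negf)
qed

lemma tail_norm_omega_IB:
  assumes polar: "\<And>R. R \<in> Q \<Longrightarrow> (\<Sum>a\<in>idx. \<nu> a * R a) \<le> 0" and i: "i \<in> IB"
  shows "tail_norm (m i) (omega \<nu> i) = omega \<nu> i 0"
proof -
  have T: "T i xs > 0" using IB_D(2,3)[OF i] by simp
  moreover have "\<nu> (Inr (Inl i)) \<le> 0" using polar_Q(1)[of \<nu> i] polar i by blast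
  ultimately have c: "- \<nu> (Inr (Inl i)) / T i xs \<ge> 0"
    by (simp add: divide_le_0_iff)
  have "tail_norm (m i) (omega \<nu> i) = tail_norm (m i) (\<lambda>j. - ((- \<nu> (Inr (Inl i)) / T i xs) * g xs i j))"
    using omega_IB(2)[OF i] by (intro tail_norm_cong) simp
  also have "\<dots> = (- \<nu> (Inr (Inl i)) / T i xs) * T i xs"
    unfolding tail_norm_minus by (rule tail_norm_scale[OF c])
  finally show ?thesis using T by (simp add: omega_IB(1)[OF i])
qed

lemma omega_in_Kcone:
  assumes polar: "\<And>R. R \<in> Q \<Longrightarrow> (\<Sum>a\<in>idx. \<nu> a * R a) \<le> 0"
  shows "omega \<nu> \<in> Kcone r m"
proof -
  have "tail_norm (m i) (omega \<nu> i) \<le> omega \<nu> i 0" for i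
  proof -
    consider "i \<in> I0" | "i \<in> IB" | "i \<notin> I0" "i \<notin> IB" by blast
    then show ?thesis
    proof cases
      case 1
      have "tail_norm (m i) (omega \<nu> i) = tail_norm (m i) (\<lambda>j. - \<nu> (Inr (Inr (i, j))))"
        using 1 by (intro tail_norm_cong omega_I0)
      then show ?thesis
        using polar_Q(2)[of \<nu> i] polar 1 m_ge_1[OF I0_D(1)[OF 1]] by (simp add: omega_I0)
    next
      case 2
      then show ?thesis using tail_norm_omega_IB[OF polar] by simp
    next
      case 3
      then have "omega \<nu> i = (\<lambda>_. 0)" by (auto simp: omega_def)
      then show ?thesis by simp
    qed
  qed
  moreover have "omega \<nu> i j = 0" if "i \<ge> r \<or> j \<ge> m i" for i j
    using that I0_D(1)[of i] IB_D(1)[of i] by (auto simp: omega_def)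
  ultimately show ?thesis
    by (auto simp: Kcone_def block_space_def topspace_Euclidean_space mem_lorentz fun_eq_iff)
qed

lemma C2_on_lagrangian:
  "C2_on UNIV (\<lambda>y. lagrangian f r m g p h y (omega \<nu>) (mu \<nu>))
    (\<lambda>y. grad f y - (\<Sum>i<r. \<Sum>j<m i. omega \<nu> i j *\<^sub>R dg i j y) + (\<Sum>i<p. \<nu> (Inl i) *\<^sub>R dh i y))
    (\<lambda>y v. hessian f y *v v - (\<Sum>i<r. \<Sum>j<m i. omega \<nu> i j *\<^sub>R ddg i j y v) + (\<Sum>i<p. \<nu> (Inl i) *\<^sub>R ddh i y v))"
proof -
  have "C2_on UNIV (\<lambda>y. f y - (\<Sum>i<r. \<Sum>j<m i. omega \<nu> i j * g y i j) + (\<Sum>i<p. \<nu> (Inl i) * h y i))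
    (\<lambda>y. grad f y - (\<Sum>i<r. \<Sum>j<m i. omega \<nu> i j *\<^sub>R dg i j y) + (\<Sum>i<p. \<nu> (Inl i) *\<^sub>R dh i y))
    (\<lambda>y v. hessian f y *v v - (\<Sum>i<r. \<Sum>j<m i. omega \<nu> i j *\<^sub>R ddg i j y v) + (\<Sum>i<p. \<nu> (Inl i) *\<^sub>R ddh i y v))"
    using data
    by (intro C2_on_add C2_on_diff C2_on_sum C2_on_cmult C2_on_g C2_on_h C2_imp_C2_on)
      (auto simp: nsocp_data_def)
  moreover have "lagrangian f r m g p h y (omega \<nu>) (mu \<nu>)
      = f y - (\<Sum>i<r. \<Sum>j<m i. omega \<nu> i j * g y i j) + (\<Sum>i<p. \<nu> (Inl i) * h y i)" for y
    by (simp add: lagrangian_def block_inner_def mu_def mult.commute)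
  ultimately show ?thesis by simp
qed

lemma KKT_of_reduced_multiplier:
  assumes polar: "\<And>R. R \<in> Q \<Longrightarrow> (\<Sum>a\<in>idx. \<nu> a * R a) \<le> 0"
    and stat: "grad f xs + (\<Sum>a\<in>idx. \<nu> a *\<^sub>R G' a xs) = 0"
  shows "KKT f r m g p h xs (omega \<nu>) (mu \<nu>)"
  unfolding KKT_def
proof (intro conjI)
  show "xs \<in> feasible r m g h" by (fact feas)
  show "omega \<nu> \<in> Kcone r m" using polar by (rule omega_in_Kcone)
  show "mu \<nu> \<in> topspace (Euclidean_space p)"
    by (simp add: mu_def topspace_Euclidean_space)
  have omega_dg: "(\<Sum>i<r. \<Sum>j<m i. omega \<nu> i j *\<^sub>R dg i j xs)
      = - ((\<Sum>i\<in>IB. \<nu> (Inr (Inl i)) *\<^sub>R gap' i xs) + (\<Sum>i\<in>I0. \<Sum>j<m i. \<nu> (Inr (Inr (i, j))) *\<^sub>R dg i j xs))"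
    unfolding gap'_def by (rule sum_omega)
  show "grad (\<lambda>y. lagrangian f r m g p h y (omega \<nu>) (mu \<nu>)) xs = 0"
    unfolding grad_hessian_of_C2_on(1)[OF C2_on_lagrangian] omega_dg
    using stat by (simp add: sum_idx algebra_simps)
  have "block_inner r m (g xs) (omega \<nu>) = (\<Sum>i<r. \<Sum>j<m i. omega \<nu> i j *\<^sub>R g xs i j)"
    by (simp add: block_inner_def mult.commute)
  also have "\<dots> = - ((\<Sum>i\<in>IB. \<nu> (Inr (Inl i)) * bd_normal i (g xs i)) + (\<Sum>i\<in>I0. \<Sum>j<m i. \<nu> (Inr (Inr (i, j))) * g xs i j))"
    unfolding sum_omega by (simp add: bd_normal_def)
  also have "\<dots> = 0" by (simp add: bd_normal_self I0_D(2))
  finally show "block_inner r m (g xs) (omega \<nu>) = 0" .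
qed

text \<open>Blocks in \<open>I\<^sub>B\<close> outside \<open>I\<^sub>B\<^sub>B\<close> have zero multiplier, so that the sum may be extended to \<open>I\<^sub>B\<close>.\<close>

lemma inner_sigma_term:
  assumes polar: "\<And>R. R \<in> Q \<Longrightarrow> (\<Sum>a\<in>idx. \<nu> a * R a) \<le> 0"
  shows "d \<bullet> (sigma_term r m g xs (omega \<nu>) *v d)
    = (\<Sum>i\<in>IB. \<nu> (Inr (Inl i)) * ((dg i 0 xs \<bullet> d)\<^sup>2 - (\<Sum>j=1..<m i. (dg i j xs \<bullet> d)\<^sup>2)) / T i xs)"
proof -
  define M where "M i = (\<lambda>d. JTmult (m i) (\<lambda>y. g y i) xs (Gam (Jmult (m i) (\<lambda>y. g y i) xs d)))" for i
  have "linear (M i)" for i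
    unfolding M_def JTmult_def Gam_def Jmult_def
    by (rule linearI)
      (auto simp: inner_add_right algebra_simps scaleR_sum_right sum.distrib[symmetric] intro!: sum.cong)
  then have M: "matrix (M i) *v d = M i d" for i
    by (simp add: matrix_works)
  have dM: "d \<bullet> M i d = (dg i 0 xs \<bullet> d)\<^sup>2 - (\<Sum>j=1..<m i. (dg i j xs \<bullet> d)\<^sup>2)" if "i \<in> IB" for i
    using m_ge_1[OF IB_D(1)[OF that]]
    by (simp add: M_def JTmult_def sum_lessThan_head Gam_def Jmult_def inner_add_right inner_diff_right inner_sum_right
        power2_eq_square inner_commute sum_negf)
  have "d \<bullet> (sigma_term r m g xs (omega \<nu>) *v d)
      = (\<Sum>i\<in>I_BB r m g xs (omega \<nu>). - (omega \<nu> i 0 / g xs i 0) * (d \<bullet> M i d))"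
    unfolding sigma_term_def M_def[symmetric] linear_sum[OF linear_matrix_vector_mult_left]
      linear_cmul[OF linear_matrix_vector_mult_left] M
    by (simp add: inner_sum_right)
  also have "\<dots> = (\<Sum>i\<in>IB. - (omega \<nu> i 0 / g xs i 0) * (d \<bullet> M i d))"
  proof (rule sum.mono_neutral_left[OF finite_index(2)])
    show "\<forall>i\<in>IB - I_BB r m g xs (omega \<nu>). - (omega \<nu> i 0 / g xs i 0) * (d \<bullet> M i d) = 0"
    proof
      fix i assume i: "i \<in> IB - I_BB r m g xs (omega \<nu>)"
      then have "omega \<nu> i \<notin> bd_plus (m i)" by (simp add: I_BB_def)
      moreover have "\<forall>j\<ge>m i. omega \<nu> i j = 0"
        by (simp add: omega_def)
      moreover have "tail_norm (m i) (omega \<nu> i) = omega \<nu> i 0"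
        using tail_norm_omega_IB[OF polar] i by blast
      ultimately have "omega \<nu> i 0 = 0"
        using mem_bd_plus[OF m_ge_1[OF IB_D(1)], of i "omega \<nu> i"] i tail_norm_nonneg[of "m i" "omega \<nu> i"]
        by auto
      then show "- (omega \<nu> i 0 / g xs i 0) * (d \<bullet> M i d) = 0" by simp
    qed
  qed (auto simp: I_BB_def)
  also have "\<dots> = (\<Sum>i\<in>IB. \<nu> (Inr (Inl i)) * ((dg i 0 xs \<bullet> d)\<^sup>2 - (\<Sum>j=1..<m i. (dg i j xs \<bullet> d)\<^sup>2)) / T i xs)"
    by (rule sum.cong) (simp_all add: dM omega_IB(1) IB_D(2))
  finally show ?thesis .
qed

text \<open>The last summand is the curvature of the cone, and it is the quadratic form of the sigma-term up to the
multiplier. The rank-one part of the second derivative of the norm becomes the square of \<open>Dg\<^sub>i\<^sub>0 d\<close> because the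
gradient of the gap annihilates \<open>d\<close>.\<close>

lemma inner_gap'':
  assumes i: "i \<in> IB" and d: "gap' i xs \<bullet> d = 0"
  shows "d \<bullet> gap'' i xs d = d \<bullet> ddg i 0 xs d - (1 / T i xs) * (\<Sum>j=1..<m i. g xs i j * (d \<bullet> ddg i j xs d))
    + ((dg i 0 xs \<bullet> d)\<^sup>2 - (\<Sum>j=1..<m i. (dg i j xs \<bullet> d)\<^sup>2)) / T i xs"
proof -
  have T: "T i xs \<noteq> 0" using IB_D(2,3)[OF i] by simp
  define X where "X = (\<Sum>j=1..<m i. g xs i j *\<^sub>R dg i j xs)"
  have "gap' i xs = dg i 0 xs - (1 / T i xs) *\<^sub>R X"
    unfolding gap'_def X_def ..
  then have "0 = dg i 0 xs \<bullet> d - (1 / T i xs) * (X \<bullet> d)"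
    using d by (simp add: inner_diff_left)
  then have "d \<bullet> X = T i xs * (dg i 0 xs \<bullet> d)"
    using T by (simp add: inner_commute field_simps)
  then have X: "(d \<bullet> X) / T i xs ^ 3 * (d \<bullet> X) = (dg i 0 xs \<bullet> d)\<^sup>2 / T i xs"
    using T by (simp add: power2_eq_square power3_eq_cube)
  have "d \<bullet> gap'' i xs d = d \<bullet> ddg i 0 xs d
      - ((1 / T i xs) * (\<Sum>j=1..<m i. g xs i j * (d \<bullet> ddg i j xs d) + (dg i j xs \<bullet> d)\<^sup>2)
        - (d \<bullet> X) / T i xs ^ 3 * (d \<bullet> X))"
    unfolding gap''_def X_def[symmetric]
    by (simp add: inner_diff_right inner_sum_right inner_add_right power2_eq_square inner_commute)
  then show ?thesis
    unfolding X sum.distrib by (simp add: algebra_simps diff_divide_distrib add_divide_distrib)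
qed

lemma WSOC_of_reduced_multiplier:
  assumes polar: "\<And>R. R \<in> Q \<Longrightarrow> (\<Sum>a\<in>idx. \<nu> a * R a) \<le> 0"
    and second: "\<And>d. \<forall>a\<in>idx. G' a xs \<bullet> d = 0 \<Longrightarrow>
      d \<bullet> (hessian f xs *v d) + (\<Sum>a\<in>idx. \<nu> a * (d \<bullet> G'' a xs d)) \<ge> 0"
  shows "WSOC f r m g p h xs (omega \<nu>) (mu \<nu>)"
  unfolding WSOC_def
proof
  fix d assume "d \<in> critical_subspace f r m g p h xs"
  then have d: "\<forall>a\<in>idx. G' a xs \<bullet> d = 0" using critical_subspace_D by blast
  then have gap0: "gap' i xs \<bullet> d = 0" if "i \<in> IB" for i
    using that by (metis G_simps(5) mem_idx(2))
  define C where "C i = ((dg i 0 xs \<bullet> d)\<^sup>2 - (\<Sum>j=1..<m i. (dg i j xs \<bullet> d)\<^sup>2)) / T i xs" for i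
  define F where "F i j = d \<bullet> ddg i j xs d" for i j
  have "d \<bullet> (hessian (\<lambda>y. lagrangian f r m g p h y (omega \<nu>) (mu \<nu>)) xs *v d)
      = d \<bullet> (hessian f xs *v d) - (\<Sum>i<r. \<Sum>j<m i. omega \<nu> i j *\<^sub>R F i j) + (\<Sum>i<p. \<nu> (Inl i) * (d \<bullet> ddh i xs d))"
    unfolding grad_hessian_of_C2_on(2)[OF C2_on_lagrangian] F_def
    by (simp add: inner_diff_right inner_add_right inner_sum_right)
  moreover have "(\<Sum>i\<in>IB. \<nu> (Inr (Inl i)) * (d \<bullet> gap'' i xs d))
      = (\<Sum>i\<in>IB. \<nu> (Inr (Inl i)) *\<^sub>R (F i 0 - (1 / T i xs) *\<^sub>R (\<Sum>j=1..<m i. g xs i j *\<^sub>R F i j)))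
        + d \<bullet> (sigma_term r m g xs (omega \<nu>) *v d)"
  proof -
    have "d \<bullet> (sigma_term r m g xs (omega \<nu>) *v d) = (\<Sum>i\<in>IB. \<nu> (Inr (Inl i)) * C i)"
      unfolding C_def times_divide_eq_right by (rule inner_sigma_term) (rule polar)
    moreover have "\<nu> (Inr (Inl i)) * (d \<bullet> gap'' i xs d)
        = \<nu> (Inr (Inl i)) *\<^sub>R (F i 0 - (1 / T i xs) *\<^sub>R (\<Sum>j=1..<m i. g xs i j *\<^sub>R F i j))
          + \<nu> (Inr (Inl i)) * C i" if "i \<in> IB" for i
      unfolding inner_gap''[OF that gap0[OF that]] C_def F_def by (simp add: distrib_left)
    ultimately show ?thesis by (simp add: sum.distrib)
  qed
  ultimately have "d \<bullet> ((hessian (\<lambda>y. lagrangian f r m g p h y (omega \<nu>) (mu \<nu>)) xs + sigma_term r m g xs (omega \<nu>)) *v d)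
      = d \<bullet> (hessian f xs *v d) + (\<Sum>a\<in>idx. \<nu> a * (d \<bullet> G'' a xs d))"
    unfolding sum_omega by (simp add: sum_idx matrix_vector_mult_add_rdistrib inner_add_right F_def)
  then show "0 \<le> d \<bullet> ((hessian (\<lambda>y. lagrangian f r m g p h y (omega \<nu>) (mu \<nu>)) xs + sigma_term r m g xs (omega \<nu>)) *v d)"
    using second[OF d] by simp
qed

end

section \<open>Weak second-order conditions for local minimizers\<close>

theorem theorem3p2:
  fixes f :: "real^'n \<Rightarrow> real"
    and r :: nat and m :: "nat \<Rightarrow> nat" and g :: "real^'n \<Rightarrow> nat \<Rightarrow> nat \<Rightarrow> real"
    and p :: nat and h :: "real^'n \<Rightarrow> nat \<Rightarrow> real"
    and xs :: "real^'n"
  assumes "nsocp_data f r m g p h"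
    and "local_minimizer f r m g h xs"
    and "robinson_cq r m g p h xs"
    and "WCR r m g p h xs"
  shows "\<exists>\<omega> \<mu>. KKT f r m g p h xs \<omega> \<mu> \<and> WSOC f r m g p h xs \<omega> \<mu>"
proof -
  interpret nsocp_point f r m g p h xs
    using assms(1,2) by unfold_locales (simp_all add: local_minimizer_def)
  obtain N where N: "open N" "xs \<in> N" and min: "\<And>y. y \<in> N \<Longrightarrow> y \<in> feasible r m g h \<Longrightarrow> f xs \<le> f y"
    using assms(2) unfolding local_minimizer_def by blast
  obtain V where V: "open V" "xs \<in> V"
    and rank: "\<And>x. x \<in> V \<Longrightarrow> dim (wcr_family r m g p h xs x) = dim (wcr_family r m g p h xs xs)"
    using assms(4) unfolding WCR_def by blast
  have f: "C2_on (regular_region \<inter> N) f (grad f) (\<lambda>x v. hessian f x *v v)"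
    using assms(1) by (intro C2_on_subset[OF C2_imp_C2_on subset_UNIV]) (simp add: nsocp_data_def)
  have "eventually (\<lambda>x. x \<in> regular_region \<inter> V) (nhds xs)"
    using open_regular_region xs_in_regular_region V by (intro eventually_nhds_in_open) auto
  then have rank': "eventually (\<lambda>x. dim ((\<lambda>a. G' a x) ` idx) = dim ((\<lambda>a. G' a xs) ` idx)) (nhds xs)"
    by eventually_elim (simp add: dim_wcr_family xs_in_regular_region rank)
  obtain \<nu> where "\<And>R. R \<in> Q \<Longrightarrow> (\<Sum>a\<in>idx. \<nu> a * R a) \<le> 0"
    "grad f xs + (\<Sum>a\<in>idx. \<nu> a *\<^sub>R G' a xs) = 0"
    "\<And>d. \<forall>a\<in>idx. G' a xs \<bullet> d = 0 \<Longrightarrow>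
      d \<bullet> (hessian f xs *v d) + (\<Sum>a\<in>idx. \<nu> a * (d \<bullet> G'' a xs d)) \<ge> 0"
  proof (rule constant_rank_second_order_necessary[OF finite_index(3), of "regular_region \<inter> N" xs f "grad f"
        "\<lambda>x v. hessian f x *v v" G G' G'' Q])
    show "open (regular_region \<inter> N)" "xs \<in> regular_region \<inter> N" using open_regular_region xs_in_regular_region N by auto
    show "C2_on (regular_region \<inter> N) (G a) (G' a) (G'' a)" if "a \<in> idx" for a
      using C2_on_subset[OF C2_on_G[OF that]] by simp
    show "\<forall>P\<in>Q. \<forall>a. a \<notin> idx \<longrightarrow> P a = 0" by (simp add: Q_def)
    show "f xs \<le> f x" if "x \<in> regular_region \<inter> N" "(\<lambda>a. if a \<in> idx then G a x else 0) \<in> Q" for x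
      using min feasible_if_reduced[of x] that by auto
  qed (use f closed_Q zero_in_Q Q_cone G_xs rank' robinson_multiplier_zero[OF assms(3)] in auto)
  then show ?thesis
    using KKT_of_reduced_multiplier WSOC_of_reduced_multiplier by blast
qed

end
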